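(* Let $\Theta=(0,1)$, let $E$ be the set of binary rationals in $(0,1)$, and for $\theta\in\Theta$ let $(T,X)$ be a random pair with distribution $R_\theta$ on $E\times(0,1)$, where the binary expansion data $K(\theta)$, $a_m(\theta)$, the function $d$ and the measures $R_\theta$ are as defined in the context. Let $\hat\theta=2X$ and $\tilde\theta=E_\theta[\hat\theta\mid T]=2T-d(T)$. (a) For each $\theta\in\Theta$ the mean squared error of the conditioned moment estimator $\tilde\theta=2T-d(T)$ is given by $$\mathrm{MSE}_\theta(\tilde\theta)=\mathrm{var}_\theta(\tilde\theta)=\frac1\theta\sum_{m=1}^{K(\theta)}a_m(\theta)\,a_{m-1}(\theta)\,\bigl(a_m(\theta)-a_{m-1}(\theta)\bigr).$$ (b) The function $\theta\mapsto\phi(\theta):=\mathrm{var}_\theta(\tilde\theta)$ is continuous on $\Theta\setminus E$, and on $E$ it is right continuous and has left hand limits. Moreover, $$\phi(\theta)-\phi(\theta-)=-\frac{1}{7q}\,2^{-2L+1}$$ if $\theta\in\Theta$ is a binary rational of the form $\theta=q2^{-L}$ with $L,q\in\mathbb{N}$ and $q$ odd.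
   Context: Binary rationals are the numbers $k2^m$ with $k\in\mathbb{Z}$ odd and $m\in\mathbb{Z}$; $E$ is the set of binary rationals in $(0,1)$. Each $\theta\in(0,1)$ has a unique binary expansion $\theta=\sum_{k=1}^{K(\theta)}2^{-j_k(\theta)}$ with positive integers $j_1(\theta)<j_2(\theta)<\cdots$, where $K(\theta)\in\mathbb{N}\cup\{\infty\}$ and where the finite expansion ($K(\theta)<\infty$) is chosen if $\theta\in E$. Put $a_0(\theta)=0$ and $a_m(\theta)=\sum_{l=1}^m2^{-j_l(\theta)}$ for $1\le m\le K(\theta)$ (finite $m$). For $t\in E$ put $d(t)=2^{-j_{K(t)}(t)}$, the value of the last digit $1$ in the finite binary expansion of $t$. Define, for $\theta\in\Theta$, weights $w_\theta(a_m(\theta))=d(a_m(\theta))/\theta$ for the indices $m\in\mathbb{N}$ with $m\le K(\theta)$, and $w_\theta(t)=0$ for all other $t\in E$. On $E\times(0,1)$ (power set of $E$, Borel $\sigma$-field on $(0,1)$) define the probability measure $R_\theta$ by $R_\theta(\{t\}\times A)=w_\theta(t)\,\mathrm{unif}(t-d(t),t)(A)$ for $t\in E$ and Borel $A\subset(0,1)$, where $\mathrm{unif}(a,b)$ is the uniform distribution on $(a,b)$. $T$ and $X$ are the coordinate projections to $E$ and $(0,1)$; under $R_\theta$, $X$ has distribution $\mathrm{unif}(0,\theta)$. $E_\theta$, $\mathrm{var}_\theta$ and $\mathrm{MSE}_\theta$ denote expectation, variance and mean squared error $E_\theta[(\tilde\theta-\theta)^2]$ under $R_\theta$. $\phi(\theta-)$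 denotes the left hand limit of $\phi$ at $\theta$. *)

theory Defs
  imports "HOL-Probability.Probability" "HOL-Library.Extended_Nat"
begin

definition binary_rationals :: "real set" where
  "binary_rationals = {of_int k * 2 powi m | k m :: int. odd k}"

definition Theta :: "real set" where
  "Theta = {0<..<1}"

definition E :: "real set" where
  "E = binary_rationals \<inter> {0<..<1}"

definition expansion_indices :: "enat \<Rightarrow> nat set" where
  "expansion_indices K = {k. 1 \<le> k \<and> enat k \<le> K}"

text \<open>
  The positions \<^term>\<open>j k\<close> of the digits 1 matter only for indices \<open>1 \<le> k \<le> K\<close>; outside this
  range they are normalised to 0, so that the pair \<open>(K, j)\<close> is unique.
\<close>

definition is_binary_expansion :: "real \<Rightarrow> enat \<Rightarrow> (nat \<Rightarrow> nat) \<Rightarrow> bool" where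
  "is_binary_expansion \<theta> K j \<longleftrightarrow>
     (\<forall>k \<in> expansion_indices K. 1 \<le> j k) \<and>
     (\<forall>k. k \<notin> expansion_indices K \<longrightarrow> j k = 0) \<and>
     strict_mono_on (expansion_indices K) j \<and>
     ((\<lambda>k. (1/2) ^ j k) has_sum \<theta>) (expansion_indices K) \<and>
     (\<theta> \<in> E \<longrightarrow> K \<noteq> \<infinity>)"

definition binary_expansion :: "real \<Rightarrow> enat \<times> (nat \<Rightarrow> nat)" where
  "binary_expansion \<theta> = (THE (K, j). is_binary_expansion \<theta> K j)"

definition exp_K :: "real \<Rightarrow> enat" where
  "exp_K \<theta> = fst (binary_expansion \<theta>)"

definition exp_j :: "real \<Rightarrow> nat \<Rightarrow> nat" where
  "exp_j \<theta> = snd (binary_expansion \<theta>)"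

definition exp_a :: "real \<Rightarrow> nat \<Rightarrow> real" where
  "exp_a \<theta> m = (\<Sum>l = 1..m. (1/2) ^ exp_j \<theta> l)"

definition last_digit :: "real \<Rightarrow> real" where
  "last_digit t = (1/2) ^ exp_j t (the_enat (exp_K t))"

definition weight :: "real \<Rightarrow> real \<Rightarrow> real" where
  "weight \<theta> t =
     (if \<exists>m \<in> expansion_indices (exp_K \<theta>). t = exp_a \<theta> m then last_digit t / \<theta> else 0)"

definition sample_algebra :: "(real \<times> real) measure" where
  "sample_algebra = count_space E \<Otimes>\<^sub>M restrict_space borel {0<..<1}"

text \<open>
  The countably additive extension to all measurable \<open>B \<subseteq> E \<times> (0,1)\<close> of the values prescribed on
  the sets \<open>{t} \<times> A\<close>; the prescription itself is recovered in \<open>emeasure_R_rectangle\<close>.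
\<close>

definition R :: "real \<Rightarrow> (real \<times> real) measure" where
  "R \<theta> = measure_of (space sample_algebra) (sets sample_algebra)
     (\<lambda>B. \<integral>\<^sup>+ t. ennreal (weight \<theta> t) *
              emeasure (uniform_measure lborel {t - last_digit t<..<t}) (Pair t -` B)
            \<partial>count_space E)"

lemma space_R: "space (R \<theta>) = E \<times> {0<..<1}"
  by (simp add: R_def sample_algebra_def space_measure_of_conv space_pair_measure space_restrict_space)

lemma sets_R: "sets (R \<theta>) = sets (count_space E \<Otimes>\<^sub>M restrict_space borel {0<..<1})"
  by (simp add: R_def sample_algebra_def)

lemma section_measurable:
  assumes "B \<in> sets sample_algebra"
  shows "Pair t -` B \<in> sets borel"
proof -
  have "Pair t -` B \<in> sets (restrict_space borel {0<..<1::real})"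
    using assms unfolding sample_algebra_def by (rule sets_Pair1)
  then show ?thesis
    by (simp add: sets_restrict_space_iff)
qed

lemma emeasure_R:
  assumes B: "B \<in> sets sample_algebra"
  shows "emeasure (R \<theta>) B =
    (\<integral>\<^sup>+ t. ennreal (weight \<theta> t) *
       emeasure (uniform_measure lborel {t - last_digit t<..<t}) (Pair t -` B) \<partial>count_space E)"
    (is "_ = ?\<mu> B")
proof (rule emeasure_measure_of[OF R_def])
  show "sets sample_algebra \<subseteq> Pow (space sample_algebra)"
    by (rule sets.space_closed)
  show "B \<in> sets (R \<theta>)"
    using B by (simp add: R_def)
  show "positive (sets (R \<theta>)) ?\<mu>"
    by (simp add: positive_def)
  show "countably_additive (sets (R \<theta>)) ?\<mu>"
  proof (rule countably_additiveI)
    fix F :: "nat \<Rightarrow> (real \<times> real) set"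
    assume F: "range F \<subseteq> sets (R \<theta>)" "disjoint_family F"
    have "F i \<in> sets sample_algebra" for i
      using F(1) by (auto simp: R_def)
    then have meas: "Pair t -` F i \<in> sets borel" for t i
      by (rule section_measurable)
    have disj: "F m \<inter> F n = {}" if "m \<noteq> n" for m n
      using F(2) that by (auto simp: disjoint_family_on_def)
    have sum: "(\<Sum>i. emeasure (uniform_measure lborel {t - last_digit t<..<t}) (Pair t -` F i))
        = emeasure (uniform_measure lborel {t - last_digit t<..<t}) (Pair t -` (\<Union>i. F i))" for t
      unfolding vimage_UN
      by (rule suminf_emeasure)
        (use meas disj in \<open>force simp: disjoint_family_on_def vimage_Int[symmetric]\<close>)+
    have "(\<Sum>i. ?\<mu> (F i)) = (\<integral>\<^sup>+ t. (\<Sum>i. ennreal (weight \<theta> t) *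
        emeasure (uniform_measure lborel {t - last_digit t<..<t}) (Pair t -` F i)) \<partial>count_space E)"
      by (rule nn_integral_suminf[symmetric]) simp
    then show "(\<Sum>i. ?\<mu> (F i)) = ?\<mu> (\<Union>i. F i)"
      by (simp add: sum)
  qed
qed

lemma emeasure_R_rectangle:
  assumes t: "t \<in> E" and A: "A \<in> sets borel" "A \<subseteq> {0<..<1}"
  shows "emeasure (R \<theta>) ({t} \<times> A) =
    ennreal (weight \<theta> t) * emeasure (uniform_measure lborel {t - last_digit t<..<t}) A"
proof -
  let ?u = "\<lambda>s. uniform_measure lborel {s - last_digit s<..<s}"
  have "{t} \<times> A \<in> sets sample_algebra"
    unfolding sample_algebra_def using t A
    by (intro pair_measureI) (auto simp: sets_restrict_space_iff)
  then have "emeasure (R \<theta>) ({t} \<times> A) = (\<integral>\<^sup>+ s. ennreal (weight \<theta> s) *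
      emeasure (?u s) (Pair s -` ({t} \<times> A)) \<partial>count_space E)"
    by (rule emeasure_R)
  also have "\<dots> = (\<integral>\<^sup>+ s. (ennreal (weight \<theta> t) * emeasure (?u t) A) * indicator {t} s \<partial>count_space E)"
    by (intro nn_integral_cong) (auto simp: indicator_def)
  also have "\<dots> = ennreal (weight \<theta> t) * emeasure (?u t) A"
    using t by (subst nn_integral_cmult_indicator) auto
  finally show ?thesis .
qed

text \<open>Estimators are functions on the sample space; \<open>T\<close> and \<open>X\<close> are \<open>fst\<close> and \<open>snd\<close>.\<close>

definition moment_est :: "real \<times> real \<Rightarrow> real" where
  "moment_est \<omega> = 2 * snd \<omega>"

definition cond_moment_est :: "real \<times> real \<Rightarrow> real" where
  "cond_moment_est \<omega> = 2 * fst \<omega> - last_digit (fst \<omega>)"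

definition sigma_T :: "(real \<times> real) measure" where
  "sigma_T = vimage_algebra (E \<times> {0<..<1}) fst (count_space E)"

definition MSE :: "real \<Rightarrow> (real \<times> real \<Rightarrow> real) \<Rightarrow> real" where
  "MSE \<theta> est = prob_space.expectation (R \<theta>) (\<lambda>\<omega>. (est \<omega> - \<theta>)\<^sup>2)"

definition var :: "real \<Rightarrow> (real \<times> real \<Rightarrow> real) \<Rightarrow> real" where
  "var \<theta> est = prob_space.variance (R \<theta>) est"

definition phi :: "real \<Rightarrow> real" where
  "phi \<theta> = var \<theta> cond_moment_est"

end

theory Submission
  imports Defs
begin

text \<open>
  Everything about the digits of \<open>x\<close> can be read off its dyadic truncations
  \<open>r n = dyadic_floor n x\<close>, the largest multiple of \<open>2\<^sup>-\<^sup>n\<close> below or at \<open>x\<close>. Passing from \<open>r (n - 1)\<close> to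
  \<open>r n\<close> adds \<open>2\<^sup>-\<^sup>n\<close> if the \<open>n\<close>-th digit is 1 and nothing otherwise. So if \<open>n\<close> is the position of the
  \<open>m\<close>-th digit 1, then \<open>r n\<close> and \<open>r (n - 1)\<close> are the partial sums \<open>a m\<close> and \<open>a (m - 1)\<close>, and for every
  \<open>G\<close> that vanishes on the diagonal
  \<open>\<Sum>m. G (a m) (a (m - 1)) = \<Sum>n. G (r (n + 1)) (r n)\<close> (lemma \<open>has_sum_expansion_iff\<close>).

  Given \<open>T = a m\<close>, an event of probability \<open>(a m - a (m - 1)) / x\<close>, the variable \<open>X\<close> is uniform on the
  interval from \<open>a (m - 1)\<close> to \<open>a m\<close>, so the conditional mean of \<open>2 X\<close> is \<open>a m + a (m - 1) = 2 T - d T\<close>.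
  With \<open>a = a m\<close> and \<open>b = a (m - 1)\<close>, the polynomial identities
  \<open>(a - b) (a + b) = a\<^sup>2 - b\<^sup>2\<close> and \<open>(a - b) (a + b)\<^sup>2 = a\<^sup>3 - b\<^sup>3 + a b (a - b)\<close> turn the first two moments of
  the estimator into telescoping sums, up to the sum of \<open>a b (a - b)\<close>. The mean is \<open>x\<close>, and what remains of
  the variance is the stated series.

  For the dependence on \<open>x\<close>, the truncation form
  \<open>phi x = 1 / x * (\<Sum>n. r (n + 1) * r n * (r (n + 1) - r n))\<close> has summands that are locally constant
  from either side and bounded by \<open>2\<^sup>-\<^sup>n\<^sup>-\<^sup>1\<close>, so one-sided limits may be taken termwise (Tannery's theorem).
  From the right \<open>r n\<close> does not change; from the left it becomes the largest multiple of \<open>2\<^sup>-\<^sup>n\<close>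
  strictly below \<open>x\<close>, which differs from \<open>r n\<close> only if \<open>x\<close> is itself a multiple of \<open>2\<^sup>-\<^sup>n\<close>. This gives
  continuity off \<open>E\<close>, and at \<open>x = q 2\<^sup>-\<^sup>L\<close> the two series differ by one term and a combination of three
  geometric series (lemma \<open>phi_jump\<close>).
\<close>

section \<open>Dyadic truncations\<close>

definition dyadic_floor :: "nat \<Rightarrow> real \<Rightarrow> real" where
  "dyadic_floor n x = of_int \<lfloor>2 ^ n * x\<rfloor> / 2 ^ n"

definition one_positions :: "real \<Rightarrow> nat set" where
  "one_positions x = {n. 1 \<le> n \<and> dyadic_floor n x \<noteq> dyadic_floor (n - 1) x}"

lemma dyadic_floor_le: "dyadic_floor n x \<le> x"
  by (simp add: dyadic_floor_def field_simps)

lemma less_dyadic_floor_add: "x < dyadic_floor n x + (1/2) ^ n"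
proof -
  have "2 ^ n * x < of_int \<lfloor>2 ^ n * x\<rfloor> + 1" by linarith
  then have "x < (of_int \<lfloor>2 ^ n * x\<rfloor> + 1) / 2 ^ n" by (simp add: field_simps)
  then show ?thesis by (simp add: dyadic_floor_def field_simps)
qed

text \<open>
  The truncation is the only multiple of \<open>2\<^sup>-\<^sup>n\<close> that exceeds \<open>x - 2\<^sup>-\<^sup>n\<close> but not \<open>x\<close>; this is how partial sums of
  expansions are recognised as truncations.
\<close>

lemma dyadic_floor_eqI:
  assumes "2 ^ n * s = of_int k" "s \<le> x" "x < s + (1/2) ^ n"
  shows "dyadic_floor n x = s"
proof -
  have "2 ^ n * x < 2 ^ n * (s + (1/2) ^ n)" using assms(3) by simp
  also have "\<dots> = of_int k + 1"
    using assms(1) by (simp add: distrib_left power_mult_distrib[symmetric])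
  finally have "2 ^ n * x < of_int k + 1" .
  moreover have "of_int k \<le> 2 ^ n * x" using assms(1,2) by (metis mult_left_mono zero_le_numeral zero_le_power)
  ultimately have "\<lfloor>2 ^ n * x\<rfloor> = k" by linarith
  then show ?thesis using assms(1) by (simp add: dyadic_floor_def field_simps)
qed

lemma dyadic_floor_Suc:
  "dyadic_floor (Suc n) x = dyadic_floor n x \<or> dyadic_floor (Suc n) x = dyadic_floor n x + (1/2) ^ Suc n"
proof -
  let ?k = "\<lfloor>2 ^ n * x\<rfloor>"
  have "of_int ?k \<le> 2 ^ n * x" "2 ^ n * x < of_int ?k + 1" by linarith+
  then have "\<lfloor>2 * (2 ^ n * x)\<rfloor> = 2 * ?k \<or> \<lfloor>2 * (2 ^ n * x)\<rfloor> = 2 * ?k + 1" by linarith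
  then show ?thesis
    by (auto simp: dyadic_floor_def field_simps)
qed

lemma dyadic_floor_0: "x \<in> Theta \<Longrightarrow> dyadic_floor 0 x = 0"
  by (simp add: dyadic_floor_def Theta_def floor_eq_iff)

lemma dyadic_floor_mono: "dyadic_floor n x \<le> dyadic_floor (Suc n) x"
  using dyadic_floor_Suc[of n x] by auto

lemma dyadic_floor_nonneg: "0 \<le> x \<Longrightarrow> 0 \<le> dyadic_floor n x"
  by (simp add: dyadic_floor_def)

lemma dyadic_floor_tendsto: "(\<lambda>n. dyadic_floor n x) \<longlonglongrightarrow> x"
proof (rule tendsto_sandwich)
  show "(\<lambda>n. x - (1/2) ^ n) \<longlonglongrightarrow> x"
    using tendsto_diff[OF tendsto_const LIMSEQ_realpow_zero[of "1/2"], of x] by simp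
  show "\<forall>\<^sub>F n in sequentially. x - (1/2) ^ n \<le> dyadic_floor n x"
    using less_dyadic_floor_add[of x] by (auto intro!: always_eventually simp: algebra_simps less_imp_le)
  show "\<forall>\<^sub>F n in sequentially. dyadic_floor n x \<le> x"
    by (simp add: dyadic_floor_le)
qed simp

lemma dyadic_floor_eq_sum:
  assumes "x \<in> Theta"
  shows "dyadic_floor n x = (\<Sum>i\<in>{i \<in> one_positions x. i \<le> n}. (1/2) ^ i)"
proof (induction n)
  case 0
  have "{i \<in> one_positions x. i \<le> 0} = {}" by (auto simp: one_positions_def)
  then show ?case using dyadic_floor_0[OF assms] by simp
next
  case (Suc n)
  have "{i \<in> one_positions x. i \<le> Suc n} =
     (if Suc n \<in> one_positions x then insert (Suc n) {i \<in> one_positions x. i \<le> n} else {i \<in> one_positions x. i \<le> n})"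
    by (auto simp: le_Suc_eq)
  then show ?case
    using dyadic_floor_Suc[of n x] Suc by (auto simp: one_positions_def)
qed

lemma one_positions_eqI:
  assumes "x \<in> Theta" "\<And>n. dyadic_floor n x = (\<Sum>i\<in>{i \<in> J. i \<le> n}. (1/2) ^ i)" "0 \<notin> J"
  shows "J = one_positions x"
proof (rule set_eqI)
  fix n
  show "n \<in> J \<longleftrightarrow> n \<in> one_positions x"
  proof (cases n)
    case (Suc m)
    have "{i \<in> J. i \<le> Suc m} = (if Suc m \<in> J then insert (Suc m) {i \<in> J. i \<le> m} else {i \<in> J. i \<le> m})"
      by (auto simp: le_Suc_eq)
    then have "dyadic_floor (Suc m) x \<noteq> dyadic_floor m x \<longleftrightarrow> Suc m \<in> J"
      unfolding assms(2) by auto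
    then show ?thesis using Suc by (simp add: one_positions_def)
  qed (use assms(3) in \<open>auto simp: one_positions_def\<close>)
qed

text \<open>
  Cancelling factors 2 brings a dyadic number into the form with odd numerator that is required in the
  definition of \<^const>\<open>binary_rationals\<close>.
\<close>

lemma dyadic_mem_E:
  assumes "x \<in> {0<..<1}" "2 ^ n * x = of_int k"
  shows "x \<in> E"
proof -
  have "\<exists>k' m. odd k' \<and> x = of_int k' * 2 powi m" using assms(2)
  proof (induction n arbitrary: k)
    case 0
    then have "of_int k > (0::real)" "of_int k < (1::real)" using assms(1) by auto
    then have "0 < k" "k < 1" by simp_all
    then show ?case by linarith
  next
    case (Suc n)
    show ?case
    proof (cases "even k")
      case True
      then have "2 ^ n * x = of_int (k div 2)" using Suc(2) by (auto elim!: evenE)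
      then show ?thesis by (rule Suc.IH)
    next
      case False
      moreover have "x = of_int k * 2 powi (- int (Suc n))"
        using Suc(2) by (subst power_int_minus, subst power_int_of_nat) (simp add: field_simps)
      ultimately show ?thesis by blast
    qed
  qed
  then show ?thesis using assms(1) by (auto simp: E_def binary_rationals_def)
qed

lemma E_dyadic:
  assumes "x \<in> E" obtains n k where "2 ^ n * x = of_int k"
proof -
  from assms obtain k m where x: "x = of_int k * 2 powi m" by (auto simp: E_def binary_rationals_def)
  have "2 ^ nat (-m) * x = of_int (k * 2 ^ nat m)"
    using x by (cases "m \<ge> 0") (auto simp: power_int_def power_mult_distrib[symmetric] field_simps)
  then show ?thesis using that by blast
qed

section \<open>Existence and uniqueness of the binary expansion\<close>

text \<open>
  The digits beyond position \<open>n\<close> contribute at most \<open>2\<^sup>-\<^sup>n\<close>, with equality only if all of them are 1. In that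
  case \<open>x\<close> would be dyadic with an infinite expansion, which is the ambiguity excluded by the
  finiteness convention on \<^const>\<open>E\<close>.
\<close>

lemma has_sum_digits_imp_dyadic_floor:
  fixes J :: "nat set"
  assumes x: "x \<in> Theta" and s: "((\<lambda>i. (1/2) ^ i) has_sum x) J"
    and fin: "x \<in> E \<Longrightarrow> finite J" 
  shows "dyadic_floor n x = (\<Sum>i\<in>{i \<in> J. i \<le> n}. (1/2) ^ i)"
proof -
  let ?s = "(\<Sum>i\<in>{i \<in> J. i \<le> n}. (1/2::real) ^ i)"
  let ?h = "\<lambda>i. (1/2::real) ^ i"
  have sN: "(\<lambda>i. if i \<in> J then ?h i else 0) sums x"
    using has_sum_cong_neutral[where S = J and T = UNIV and f = ?h and g = "\<lambda>i. if i \<in> J then ?h i else 0"] s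
    by (intro has_sum_imp_sums) auto
  let ?f = "\<lambda>i. if i \<in> J then ?h i else 0"
  have head: "(\<Sum>i<Suc n. ?f i) = ?s"
  proof -
    have "{i \<in> {..<Suc n}. i \<in> J} = {i \<in> J. i \<le> n}" by auto
    then show ?thesis
      using sum.inter_filter[of "{..<Suc n}" ?h "\<lambda>i. i \<in> J"] by simp
  qed
  have tail: "(\<lambda>i. ?f (i + Suc n)) sums (x - ?s)"
    using sums_split_initial_segment[OF sN, of "Suc n"] head by simp
  have g: "(\<lambda>i. ?h (i + Suc n)) sums (?h n)"
    using sums_mult[OF power_half_series, of "?h n"] by (simp add: power_add algebra_simps)
  have int: "2 ^ n * ?s = of_int (\<Sum>i\<in>{i \<in> J. i \<le> n}. 2 ^ (n - i))"
  proof -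
    have "2 ^ n * (1/2::real) ^ i = of_int (2 ^ (n - i))" if "i \<le> n" for i
    proof -
      have "(2::real) ^ n = 2 ^ (n - i) * 2 ^ i" using that by (simp flip: power_add)
      then show ?thesis by (simp add: power_one_over)
    qed
    then show ?thesis by (simp add: sum_distrib_left)
  qed
  have ge: "?s \<le> x"
    using sums_le[OF _ sums_zero tail] by simp
  have le: "x - ?s \<le> ?h n" by (rule sums_le[OF _ tail g]) auto
  \<comment> \<open>Equality forces every digit after position \<open>n\<close> to be 1.\<close>
  have "x - ?s \<noteq> ?h n"
  proof
    assume eq: "x - ?s = ?h n"
    have "(\<lambda>i. ?h (i + Suc n) - ?f (i + Suc n)) sums 0"
      using sums_diff[OF g tail] eq by simp
    then have z: "\<forall>i. ?h (i + Suc n) - ?f (i + Suc n) = 0"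
      using suminf_eq_zero_iff[of "\<lambda>i. ?h (i + Suc n) - ?f (i + Suc n)"] by (simp add: sums_iff)
    have "i + Suc n \<in> J" for i
      using spec[OF z, of i] by (rule contrapos_pp) simp
    then have sub: "range (\<lambda>i. i + Suc n) \<subseteq> J" by auto
    have "2 ^ n * x = of_int ((\<Sum>i\<in>{i \<in> J. i \<le> n}. 2 ^ (n - i)) + 1)"
      using int eq by (simp add: algebra_simps power_mult_distrib[symmetric])
    then have "x \<in> E" using x unfolding Theta_def by (intro dyadic_mem_E)
    then have "finite (range (\<lambda>i. i + Suc n))" using fin sub finite_subset by blast
    then show False by (simp add: finite_image_iff inj_on_def)
  qed
  with le have "x < ?s + ?h n" by linarith
  then show ?thesis using dyadic_floor_eqI[OF int ge] by simp
qed

lemma one_positions_pos: "n \<in> one_positions x \<Longrightarrow> 1 \<le> n"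
  by (simp add: one_positions_def)

lemma digit_increment:
  "dyadic_floor (Suc n) x - dyadic_floor n x = (if Suc n \<in> one_positions x then (1/2) ^ Suc n else 0)"
  using dyadic_floor_Suc[of n x] by (auto simp: one_positions_def)

lemma finite_one_positions:
  assumes "x \<in> E" shows "finite (one_positions x)"
proof -
  obtain n k where nk: "2 ^ n * x = of_int k" using E_dyadic[OF assms] .
  have "dyadic_floor m x = x" if "n \<le> m" for m
  proof (rule dyadic_floor_eqI)
    have "(2::real) ^ m = 2 ^ (m - n) * 2 ^ n" using that by (simp flip: power_add)
    then show "2 ^ m * x = of_int (2 ^ (m - n) * k)" using nk by simp
  qed auto
  note stable = this
  have "m \<le> n" if "m \<in> one_positions x" for m
  proof (rule ccontr)
    assume "\<not> m \<le> n"
    then have "dyadic_floor m x = x" "dyadic_floor (m - 1) x = x" by (auto intro!: stable)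
    then show False using that by (simp add: one_positions_def)
  qed
  then have "one_positions x \<subseteq> {..n}" by auto
  then show ?thesis using finite_subset by blast
qed

text \<open>
  The rank of a position among all positions of digits 1 is its index in the expansion. This is what
  recovers the enumeration \<open>j\<close> from the set of its values.
\<close>

lemma card_image_initial:
  fixes j :: "nat \<Rightarrow> nat"
  assumes j: "strict_mono_on (expansion_indices K) j" and k: "k \<in> expansion_indices K"
  shows "{i \<in> j ` expansion_indices K. i \<le> j k} = j ` {1..k}" "card (j ` {1..k}) = k"
proof -
  have sub: "{1..k} \<subseteq> expansion_indices K"
    using k by (auto simp: expansion_indices_def intro: order_trans[of _ "enat k"])
  show "{i \<in> j ` expansion_indices K. i \<le> j k} = j ` {1..k}"
  proof (intro set_eqI iffI)
    fix i assume "i \<in> {i \<in> j ` expansion_indices K. i \<le> j k}"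
    then obtain l where l: "l \<in> expansion_indices K" "i = j l" "j l \<le> j k" by auto
    then have "l \<le> k" using strict_mono_onD[OF j k l(1)] by force
    then show "i \<in> j ` {1..k}" using l by (auto simp: expansion_indices_def)
  next
    fix i assume "i \<in> j ` {1..k}"
    then show "i \<in> {i \<in> j ` expansion_indices K. i \<le> j k}"
      using sub strict_mono_on_leD[OF j _ k] by auto
  qed
  have "inj_on j {1..k}" using strict_mono_on_imp_inj_on[OF j] sub inj_on_subset by blast
  then show "card (j ` {1..k}) = k" by (simp add: card_image)
qed

lemma expansion_indices_finite: "finite (expansion_indices K) \<longleftrightarrow> K \<noteq> \<infinity>"
proof (cases K)
  case (enat n)
  then have "expansion_indices K = {1..n}" by (auto simp: expansion_indices_def)
  then show ?thesis using enat by simp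
next
  case infinity
  then have "expansion_indices K = {1..}" by (auto simp: expansion_indices_def)
  then show ?thesis using infinity by (simp add: infinite_Ici)
qed

lemma expansion_indices_inj:
  assumes "expansion_indices K = expansion_indices K'" shows "K = K'"
proof -
  have card: "card (expansion_indices (enat n)) = n" for n
  proof -
    have "expansion_indices (enat n) = {1..n}" by (auto simp: expansion_indices_def)
    then show ?thesis by simp
  qed
  have "K \<noteq> \<infinity> \<longleftrightarrow> K' \<noteq> \<infinity>"
    by (metis assms expansion_indices_finite)
  then show ?thesis
    by (cases K; cases K') (use assms card in \<open>auto dest: arg_cong[where f = card]\<close>)
qed

lemma is_binary_expansion_positions:
  assumes x: "x \<in> Theta" and b: "is_binary_expansion x K j"
  shows "j ` expansion_indices K = one_positions x"
proof (rule one_positions_eqI[OF x])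
  have inj: "inj_on j (expansion_indices K)"
    using b by (auto simp: is_binary_expansion_def intro: strict_mono_on_imp_inj_on)
  have "((\<lambda>i. (1/2) ^ i) has_sum x) (j ` expansion_indices K)"
    using b by (simp add: has_sum_reindex[OF inj] o_def is_binary_expansion_def)
  then show "dyadic_floor n x = (\<Sum>i\<in>{i \<in> j ` expansion_indices K. i \<le> n}. (1/2) ^ i)" for n
  proof (rule has_sum_digits_imp_dyadic_floor[OF x])
    show "x \<in> E \<Longrightarrow> finite (j ` expansion_indices K)"
      using b expansion_indices_finite by (auto simp: is_binary_expansion_def)
  qed
  show "0 \<notin> j ` expansion_indices K"
    using b by (force simp: is_binary_expansion_def)
qed

lemma card_initial_strict_mono:
  fixes J :: "nat set"
  assumes "a < b" "b \<in> J"
  shows "card {i \<in> J. i \<le> a} < card {i \<in> J. i \<le> b}"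
proof (rule psubset_card_mono)
  have "b \<in> {i \<in> J. i \<le> b} - {i \<in> J. i \<le> a}" using assms by simp
  then show "{i \<in> J. i \<le> a} \<subset> {i \<in> J. i \<le> b}" using assms(1) by fastforce
qed simp

text \<open>
  Any expansion has the positions \<^term>\<open>one_positions x\<close>, and equal sets of positions are enumerated
  equally because the rank determines the index.
\<close>

lemma is_binary_expansion_unique:
  assumes x: "x \<in> Theta" and b: "is_binary_expansion x K j" "is_binary_expansion x K' j'"
  shows "K = K' \<and> j = j'"
proof -
  let ?J = "one_positions x"
  have J: "j ` expansion_indices K = ?J" "j' ` expansion_indices K' = ?J"
    using is_binary_expansion_positions[OF x] b by auto
  have m: "strict_mono_on (expansion_indices K) j" "strict_mono_on (expansion_indices K') j'"
    using b by (auto simp: is_binary_expansion_def)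
  have c: "k \<in> expansion_indices K \<Longrightarrow> card {i \<in> ?J. i \<le> j k} = k"
          "k \<in> expansion_indices K' \<Longrightarrow> card {i \<in> ?J. i \<le> j' k} = k" for k
    using card_image_initial[OF m(1), of k] card_image_initial[OF m(2), of k] unfolding J by simp_all
  have inj: "a = b" if "a \<in> ?J" "b \<in> ?J" "card {i \<in> ?J. i \<le> a} = card {i \<in> ?J. i \<le> b}" for a b
    using card_initial_strict_mono[of a b ?J] card_initial_strict_mono[of b a ?J] that by (metis less_irrefl linorder_neqE_nat)
  let ?r = "\<lambda>a. card {i \<in> ?J. i \<le> a}"
  have "?r ` ?J = (\<lambda>k. ?r (j k)) ` expansion_indices K" "?r ` ?J = (\<lambda>k. ?r (j' k)) ` expansion_indices K'"
    using image_image[of ?r j "expansion_indices K"] image_image[of ?r j' "expansion_indices K'"] J by simp_all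
  moreover have "(\<lambda>k. ?r (j k)) ` expansion_indices K = expansion_indices K"
    "(\<lambda>k. ?r (j' k)) ` expansion_indices K' = expansion_indices K'"
    using c by simp_all
  ultimately have "expansion_indices K = expansion_indices K'" by simp
  then have K: "K = K'" by (rule expansion_indices_inj)
  have "j k = j' k" for k
  proof (cases "k \<in> expansion_indices K")
    case True
    then have "j k \<in> ?J" "j' k \<in> ?J" using J K by blast+
    moreover have "?r (j k) = ?r (j' k)" using c True K by metis
    ultimately show ?thesis by (rule inj)
  next
    case False
    then show ?thesis using b K by (simp add: is_binary_expansion_def)
  qed
  then show ?thesis using K by auto
qed

lemma one_positions_has_sum:
  assumes "x \<in> Theta"
  shows "((\<lambda>i. (1/2) ^ i) has_sum x) (one_positions x)"
proof -
  have "(\<lambda>n. dyadic_floor (Suc n) x - dyadic_floor n x) sums (x - dyadic_floor 0 x)"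
    by (rule telescope_sums[OF dyadic_floor_tendsto])
  then have "(\<lambda>n. if Suc n \<in> one_positions x then (1/2) ^ Suc n else 0) sums x"
    by (simp only: digit_increment dyadic_floor_0[OF assms] diff_zero)
  then have "((\<lambda>n. if Suc n \<in> one_positions x then (1/2) ^ Suc n else 0) has_sum x) UNIV"
    by (rule sums_nonneg_imp_has_sum) auto
  then have "((\<lambda>n. if n \<in> one_positions x then (1/2) ^ n else 0) has_sum x) (range Suc)"
    by (simp add: has_sum_reindex o_def)
  then show ?thesis
  proof (subst has_sum_cong_neutral)
    show "\<And>n. n \<in> one_positions x - range Suc \<Longrightarrow> (1/2::real) ^ n = 0"
      using one_positions_pos by (metis DiffE Suc_le_D One_nat_def rangeI)
  qed auto
qed

text \<open>
  The increasing enumeration of \<^term>\<open>one_positions x\<close> is an expansion. Its digits 1 are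
  indexed from 1, whereas \<^const>\<open>enumerate\<close> indexes from 0.
\<close>

lemma is_binary_expansion_exists:
  assumes x: "x \<in> Theta"
  shows "\<exists>K j. is_binary_expansion x K j"
proof -
  let ?J = "one_positions x"
  define K where "K = (if finite ?J then enat (card ?J) else \<infinity>)"
  define j where "j k = (if k \<in> expansion_indices K then enumerate ?J (k - 1) else 0)" for k
  have K: "k \<in> expansion_indices K \<longleftrightarrow> 1 \<le> k \<and> (finite ?J \<longrightarrow> k - 1 < card ?J)" for k
    by (auto simp: expansion_indices_def K_def)
  have mono: "strict_mono_on (expansion_indices K) j"
  proof (rule strict_mono_onI)
    fix a b assume ab: "a \<in> expansion_indices K" "b \<in> expansion_indices K" "a < b"
    then have "a - 1 < b - 1" using K[of a] by auto
    then show "j a < j b" using ab K[of b] enumerate_mono[of "a - 1" "b - 1" ?J] finite_enumerate_mono[of "a - 1" "b - 1" ?J]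
      by (cases "finite ?J") (auto simp: j_def)
  qed
  have img: "j ` expansion_indices K = ?J"
  proof (intro set_eqI iffI)
    fix i assume "i \<in> j ` expansion_indices K"
    then show "i \<in> ?J" using K enumerate_in_set[of ?J] finite_enumerate_in_set[of ?J]
      by (cases "finite ?J") (auto simp: j_def)
  next
    fix i assume i: "i \<in> ?J"
    obtain n where n: "enumerate ?J n = i" "finite ?J \<longrightarrow> n < card ?J"
      using finite_enumerate_Ex[OF _ i] enumerate_Ex[OF _ i] by (cases "finite ?J") auto
    then have "Suc n \<in> expansion_indices K" using K[of "Suc n"] by simp
    moreover from this have "j (Suc n) = i" using n by (simp add: j_def)
    ultimately show "i \<in> j ` expansion_indices K" by blast
  qed
  have "((\<lambda>k. (1/2) ^ j k) has_sum x) (expansion_indices K)"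
    using one_positions_has_sum[OF x] has_sum_reindex[OF strict_mono_on_imp_inj_on[OF mono], of "\<lambda>i. (1/2::real) ^ i" x]
    by (simp add: img o_def)
  moreover have "1 \<le> j k" if "k \<in> expansion_indices K" for k
    using img that one_positions_pos by blast
  moreover have "x \<in> E \<longrightarrow> K \<noteq> \<infinity>" using finite_one_positions by (simp add: K_def)
  ultimately have "is_binary_expansion x K j"
    using mono by (simp add: is_binary_expansion_def j_def)
  then show ?thesis by blast
qed

lemma binary_expansion_eqI:
  assumes "x \<in> Theta" "is_binary_expansion x K j"
  shows "exp_K x = K" "exp_j x = j"
proof -
  have "binary_expansion x = (K, j)"
    unfolding binary_expansion_def
    by (rule the_equality) (use assms is_binary_expansion_unique[OF assms(1)] in auto)
  then show "exp_K x = K" "exp_j x = j" by (simp_all add: exp_K_def exp_j_def)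
qed

lemma is_binary_expansion_exp:
  assumes "x \<in> Theta" shows "is_binary_expansion x (exp_K x) (exp_j x)"
  using is_binary_expansion_exists[OF assms] binary_expansion_eqI[OF assms] by metis

section \<open>Partial sums of the expansion\<close>

lemma exp_j_bij_betw:
  assumes "x \<in> Theta"
  shows "bij_betw (exp_j x) (expansion_indices (exp_K x)) (one_positions x)"
  using is_binary_expansion_exp[OF assms] is_binary_expansion_positions[OF assms]
  by (auto simp: bij_betw_def is_binary_expansion_def intro: strict_mono_on_imp_inj_on)

lemma exp_a_eq_dyadic_floor:
  assumes x: "x \<in> Theta" and m: "m \<in> expansion_indices (exp_K x)"
  shows "exp_a x m = dyadic_floor (exp_j x m) x"
proof -
  have mono: "strict_mono_on (expansion_indices (exp_K x)) (exp_j x)"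
    using is_binary_expansion_exp[OF x] by (simp add: is_binary_expansion_def)
  have "inj_on (exp_j x) {1..m}"
    using card_image_initial(2)[OF mono m] by (intro eq_card_imp_inj_on) auto
  then have "exp_a x m = (\<Sum>i\<in>exp_j x ` {1..m}. (1/2) ^ i)"
    by (simp add: exp_a_def sum.reindex)
  also have "exp_j x ` {1..m} = {i \<in> one_positions x. i \<le> exp_j x m}"
    using card_image_initial(1)[OF mono m] exp_j_bij_betw[OF x] by (simp add: bij_betw_def)
  finally show ?thesis by (simp add: dyadic_floor_eq_sum[OF x])
qed

lemma exp_j_mem:
  assumes "x \<in> Theta" "m \<in> expansion_indices (exp_K x)"
  shows "exp_j x m \<in> one_positions x" "1 \<le> exp_j x m"
  using exp_j_bij_betw[OF assms(1)] assms(2) one_positions_pos by (auto simp: bij_betw_def)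

lemma exp_a_diff:
  assumes "m \<in> expansion_indices K"
  shows "exp_a x m - exp_a x (m - 1) = (1/2) ^ exp_j x m"
  using assms by (cases m) (auto simp: exp_a_def expansion_indices_def)

lemma exp_a_pred_eq_dyadic_floor:
  assumes x: "x \<in> Theta" and m: "m \<in> expansion_indices (exp_K x)"
  shows "exp_a x (m - 1) = dyadic_floor (exp_j x m - 1) x"
proof -
  have "dyadic_floor (exp_j x m) x - dyadic_floor (exp_j x m - 1) x = (1/2) ^ exp_j x m"
    using digit_increment[of "exp_j x m - 1" x] exp_j_mem[OF assms] by simp
  then show ?thesis using exp_a_diff[OF m, of x] exp_a_eq_dyadic_floor[OF assms] by linarith
qed

lemma exp_a_bounds:
  assumes x: "x \<in> Theta" and m: "m \<in> expansion_indices (exp_K x)"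
  shows "0 \<le> exp_a x (m - 1)" "exp_a x (m - 1) < exp_a x m" "exp_a x m \<le> x"
proof -
  show "0 \<le> exp_a x (m - 1)" "exp_a x m \<le> x"
    using x by (auto simp: exp_a_eq_dyadic_floor[OF assms] exp_a_pred_eq_dyadic_floor[OF assms] Theta_def
        simp del: One_nat_def intro: dyadic_floor_nonneg dyadic_floor_le)
  have "0 < (1/2::real) ^ exp_j x m" by simp
  then show "exp_a x (m - 1) < exp_a x m" using exp_a_diff[OF m, of x] by linarith
qed

text \<open>
  At a digit 0 two consecutive truncations agree, so a summand vanishing on the diagonal does not see
  the digits 0 and the sum over the digits 1 becomes a sum over all positions.
  The right-hand side no longer refers to \<^const>\<open>binary_expansion\<close>.
\<close>

lemma has_sum_expansion_iff:
  fixes G :: "real \<Rightarrow> real \<Rightarrow> real"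
  assumes x: "x \<in> Theta" and G: "\<And>y. G y y = 0"
  shows "((\<lambda>m. G (exp_a x m) (exp_a x (m - 1))) has_sum s) (expansion_indices (exp_K x)) \<longleftrightarrow>
    ((\<lambda>n. G (dyadic_floor (Suc n) x) (dyadic_floor n x)) has_sum s) UNIV"
proof -
  let ?H = "\<lambda>n. G (dyadic_floor n x) (dyadic_floor (n - 1) x)"
  have "((\<lambda>m. G (exp_a x m) (exp_a x (m - 1))) has_sum s) (expansion_indices (exp_K x)) \<longleftrightarrow>
      ((\<lambda>m. ?H (exp_j x m)) has_sum s) (expansion_indices (exp_K x))"
    by (intro has_sum_cong) (simp add: exp_a_eq_dyadic_floor[OF x] exp_a_pred_eq_dyadic_floor[OF x] del: One_nat_def)
  also have "\<dots> \<longleftrightarrow> (?H has_sum s) (one_positions x)"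
    by (rule has_sum_reindex_bij_betw[OF exp_j_bij_betw[OF x]])
  also have "\<dots> \<longleftrightarrow> (?H has_sum s) (range Suc)"
  proof (rule has_sum_cong_neutral)
    fix n assume "n \<in> range Suc - one_positions x"
    then show "?H n = 0" using G by (auto simp: one_positions_def)
  next
    fix n assume "n \<in> one_positions x - range Suc"
    then show "?H n = 0" using one_positions_pos[of n x] by (cases n) auto
  qed simp
  also have "\<dots> \<longleftrightarrow> ((\<lambda>n. ?H (Suc n)) has_sum s) UNIV"
    by (simp add: has_sum_reindex o_def)
  finally show ?thesis by simp
qed

lemma exp_a_powers_telescope:
  assumes x: "x \<in> Theta" and p: "0 < p"
  shows "((\<lambda>m. exp_a x m ^ p - exp_a x (m - 1) ^ p) has_sum x ^ p) (expansion_indices (exp_K x))"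
proof (subst has_sum_expansion_iff[OF x, where G = "\<lambda>y z. y ^ p - z ^ p"])
  have "(\<lambda>n. dyadic_floor (Suc n) x ^ p - dyadic_floor n x ^ p) sums (x ^ p - dyadic_floor 0 x ^ p)"
    by (intro telescope_sums tendsto_power dyadic_floor_tendsto)
  then have "(\<lambda>n. dyadic_floor (Suc n) x ^ p - dyadic_floor n x ^ p) sums x ^ p"
    using p by (simp add: dyadic_floor_0[OF x] zero_power)
  then show "((\<lambda>n. dyadic_floor (Suc n) x ^ p - dyadic_floor n x ^ p) has_sum x ^ p) UNIV"
    using x by (intro sums_nonneg_imp_has_sum)
      (auto simp: Theta_def intro!: power_mono dyadic_floor_mono dyadic_floor_nonneg)
qed simp

text \<open>
  Cutting the expansion of \<open>x\<close> after its \<open>m\<close>-th digit 1 is the finite expansion of the partial sum, so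
  the last digit of the partial sum is the \<open>m\<close>-th digit 1 of \<open>x\<close>.
\<close>

lemma expansion_of_exp_a:
  assumes x: "x \<in> Theta" and m: "m \<in> expansion_indices (exp_K x)"
  shows "exp_a x m \<in> E" "last_digit (exp_a x m) = exp_a x m - exp_a x (m - 1)"
proof -
  let ?j = "\<lambda>k. if k \<le> m then exp_j x k else 0"
  have I: "expansion_indices (enat m) = {1..m}" by (auto simp: expansion_indices_def)
  have sub: "{1..m} \<subseteq> expansion_indices (exp_K x)"
    using m by (auto simp: expansion_indices_def intro: order_trans[of _ "enat m"])
  have b: "is_binary_expansion x (exp_K x) (exp_j x)" by (rule is_binary_expansion_exp[OF x])
  have Th: "exp_a x m \<in> {0<..<1}"
    using exp_a_bounds[OF assms] x by (auto simp: Theta_def)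
  have "2 ^ exp_j x m * exp_a x m = of_int \<lfloor>2 ^ exp_j x m * x\<rfloor>"
    unfolding exp_a_eq_dyadic_floor[OF assms] by (simp add: dyadic_floor_def)
  then show "exp_a x m \<in> E" by (rule dyadic_mem_E[OF Th])
  have "is_binary_expansion (exp_a x m) (enat m) ?j"
    unfolding is_binary_expansion_def I
  proof (intro conjI ballI allI impI)
    show "1 \<le> ?j k" if "k \<in> {1..m}" for k
      using that sub exp_j_mem(2)[OF x, of k] by auto
    show "?j k = 0" if "k \<notin> {1..m}" for k
    proof (cases "k \<le> m")
      case True
      then have "k = 0" using that by auto
      then show ?thesis using b by (auto simp: is_binary_expansion_def expansion_indices_def)
    qed simp
    have "strict_mono_on {1..m} (exp_j x)"
      using b sub by (auto simp: is_binary_expansion_def intro: monotone_on_subset)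
    then show "strict_mono_on {1..m} ?j" by (auto simp: strict_mono_on_def)
    have "((\<lambda>k. (1/2) ^ ?j k) has_sum (\<Sum>k\<in>{1..m}. (1/2) ^ ?j k)) {1..m}"
      by (rule has_sum_finite) simp
    then show "((\<lambda>k. (1/2) ^ ?j k) has_sum exp_a x m) {1..m}"
      by (simp add: exp_a_def)
  qed simp
  moreover have "exp_a x m \<in> Theta" using Th by (simp add: Theta_def)
  ultimately have "exp_K (exp_a x m) = enat m" "exp_j (exp_a x m) = ?j"
    by (auto intro: binary_expansion_eqI)
  then show "last_digit (exp_a x m) = exp_a x m - exp_a x (m - 1)"
    using exp_a_diff[OF m, of x] by (simp add: last_digit_def)
qed

lemma exp_a_inj_on:
  assumes x: "x \<in> Theta"
  shows "inj_on (exp_a x) (expansion_indices (exp_K x))"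
proof (rule inj_onI)
  fix m n assume mn: "m \<in> expansion_indices (exp_K x)" "n \<in> expansion_indices (exp_K x)" "exp_a x m = exp_a x n"
  have "m \<le> n \<Longrightarrow> exp_a x m \<le> exp_a x n - (if m < n then (1/2) ^ exp_j x n else 0)" for m n
    unfolding exp_a_def by (cases n) (auto intro!: sum_mono2)
  moreover have "0 < (1/2::real) ^ exp_j x k" for k by simp
  ultimately show "m = n"
    using mn(3) by (smt (verit) nat_neq_iff order_less_imp_le)
qed

lemma weight_exp_a:
  assumes "x \<in> Theta" "m \<in> expansion_indices (exp_K x)"
  shows "weight x (exp_a x m) = (exp_a x m - exp_a x (m - 1)) / x"
  using assms expansion_of_exp_a[OF assms] by (auto simp: weight_def)

lemma weight_nonneg: "x \<in> Theta \<Longrightarrow> 0 \<le> weight x t"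
  by (auto simp: weight_def last_digit_def Theta_def)

lemma weight_nonzeroE:
  assumes "weight x t \<noteq> 0"
  obtains m where "m \<in> expansion_indices (exp_K x)" "t = exp_a x m"
  using assms by (auto simp: weight_def split: if_splits)

lemma error_terms_summable:
  assumes x: "x \<in> Theta"
  shows "(\<lambda>m. exp_a x m * exp_a x (m - 1) * (exp_a x m - exp_a x (m - 1))) summable_on expansion_indices (exp_K x)"
proof (rule summable_on_comparison_test)
  show "(\<lambda>m. exp_a x m - exp_a x (m - 1)) summable_on expansion_indices (exp_K x)"
    using exp_a_powers_telescope[OF x, of 1] by (auto simp: summable_on_def)
next
  fix m assume m: "m \<in> expansion_indices (exp_K x)"
  note b = exp_a_bounds[OF x m]
  have "exp_a x m * exp_a x (m - 1) \<le> 1"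
    using b x by (intro mult_le_one) (auto simp: Theta_def)
  then show "exp_a x m * exp_a x (m - 1) * (exp_a x m - exp_a x (m - 1)) \<le> exp_a x m - exp_a x (m - 1)"
    using b by (intro mult_left_le_one_le) auto
  show "0 \<le> exp_a x m * exp_a x (m - 1) * (exp_a x m - exp_a x (m - 1))"
    using b by auto
qed

section \<open>The distribution of T and moments of the estimator\<close>

text \<open>
  Unordered convergence of real sums is absolute, so the sums over digits are Bochner integrals with
  respect to counting measure.
\<close>

lemma has_sum_imp_infsetsum_nat:
  fixes f :: "nat \<Rightarrow> real"
  assumes "(f has_sum s) A"
  shows "Infinite_Set_Sum.abs_summable_on f A" "infsetsum f A = s"
proof -
  let ?f = "\<lambda>n. if n \<in> A then f n else 0"
  have h: "(?f has_sum s) UNIV"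
    using assms has_sum_cong_neutral[where S = A and T = UNIV and f = f and g = ?f] by auto
  then have "(\<lambda>n. norm (?f n)) summable_on UNIV"
    using summable_on_iff_abs_summable_on_real[of ?f UNIV] by (auto simp: summable_on_def)
  then have "summable (\<lambda>n. norm (?f n))" by (rule summable_on_imp_summable)
  moreover have "(\<lambda>n. norm (?f n)) = (\<lambda>n. if n \<in> A then norm (f n) else 0)" by auto
  ultimately show sm: "Infinite_Set_Sum.abs_summable_on f A" by (simp add: abs_summable_on_nat_iff)
  show "infsetsum f A = s"
    using has_sum_imp_sums[OF h] by (simp add: infsetsum_nat[OF sm] sums_iff)
qed

text \<open>
  The weights are carried by the distinct points \<^term>\<open>exp_a x m\<close>, so integrals against them are sums
  over the digits of \<open>x\<close>.
\<close>

lemma integral_weight: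
  assumes x: "x \<in> Theta"
    and s: "((\<lambda>m. (exp_a x m - exp_a x (m - 1)) / x * g (exp_a x m)) has_sum s) (expansion_indices (exp_K x))"
  shows "integrable (count_space E) (\<lambda>t. weight x t * g t)"
    and "(\<integral>t. weight x t * g t \<partial>count_space E) = s"
proof -
  let ?I = "expansion_indices (exp_K x)" and ?f = "\<lambda>t. weight x t * g t"
  have s': "((\<lambda>m. ?f (exp_a x m)) has_sum s) ?I"
    using s by (rule has_sum_cong[THEN iffD1, rotated]) (simp add: weight_exp_a[OF x])
  note nat = has_sum_imp_infsetsum_nat[OF s']
  have bij: "bij_betw (exp_a x) ?I (exp_a x ` ?I)"
    by (simp add: bij_betw_def exp_a_inj_on[OF x])
  have out: "?f t = 0" if "t \<in> E - exp_a x ` ?I" for t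
    using that weight_nonzeroE[of x t] by force
  have sub: "exp_a x ` ?I \<subseteq> E" using expansion_of_exp_a(1)[OF x] by auto
  have "Infinite_Set_Sum.abs_summable_on ?f (exp_a x ` ?I)"
    using nat(1) abs_summable_on_reindex_bij_betw[OF bij, of ?f] by simp
  then have "Infinite_Set_Sum.abs_summable_on ?f E"
    using abs_summable_on_cong_neutral[of E "exp_a x ` ?I" ?f ?f] out sub by blast
  then show "integrable (count_space E) ?f" by (simp add: abs_summable_on_def)
  have "infsetsum ?f E = infsetsum ?f (exp_a x ` ?I)"
    by (rule infsetsum_cong_neutral) (use out sub in auto)
  also have "\<dots> = s"
    using nat(2) infsetsum_reindex_bij_betw[OF bij, of ?f] by simp
  finally show "(\<integral>t. ?f t \<partial>count_space E) = s" by (simp add: infsetsum_def)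
qed

text \<open>
  On the support of \<open>T\<close> the interval on which \<open>X\<close> lives is contained in the unit interval, hence no mass
  of the uniform distribution is lost on \<^term>\<open>{0<..<1::real}\<close>.
\<close>

lemma fibre_interval:
  assumes x: "x \<in> Theta" and w: "weight x t \<noteq> 0"
  shows "0 \<le> t - last_digit t" "0 < last_digit t" "t < 1"
proof -
  obtain m where m: "m \<in> expansion_indices (exp_K x)" "t = exp_a x m"
    using weight_nonzeroE[OF w] .
  show "0 \<le> t - last_digit t" "0 < last_digit t" "t < 1"
    using exp_a_bounds[OF x m(1)] expansion_of_exp_a(2)[OF x m(1)] x m(2) by (auto simp: Theta_def)
qed

lemma measurable_fst_R [measurable]: "fst \<in> measurable (R x) (count_space E)"
  using measurable_fst measurable_cong_sets[OF sets_R refl] by blast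

lemma measurable_snd_R: "snd \<in> measurable (R x) (restrict_space borel {0<..<1})"
  using measurable_snd measurable_cong_sets[OF sets_R refl] by blast

lemma borel_measurable_snd_R [measurable]: "snd \<in> borel_measurable (R x)"
  using measurable_snd_R by (simp add: measurable_restrict_space2_iff)

lemma distr_fst_R:
  assumes x: "x \<in> Theta"
  shows "distr (R x) (count_space E) fst = density (count_space E) (\<lambda>t. ennreal (weight x t))"
proof (rule measure_eqI)
  fix A assume "A \<in> sets (distr (R x) (count_space E) fst)"
  then have A: "A \<subseteq> E" by simp
  have eq: "fst -` A \<inter> space (R x) = A \<times> {0<..<1}" using A by (auto simp: space_R)
  have meas: "A \<times> {0<..<1} \<in> sets sample_algebra"
    unfolding sample_algebra_def using A by (intro pair_measureI) (auto simp: sets_restrict_space_iff)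
  have pt: "ennreal (weight x t) * emeasure (uniform_measure lborel {t - last_digit t<..<t}) (Pair t -` (A \<times> {0<..<1}))
      = ennreal (weight x t) * indicator A t" for t
  proof (cases "weight x t = 0 \<or> t \<notin> A")
    case False
    note f = fibre_interval[OF x, of t]
    have "emeasure (uniform_measure lborel {t - last_digit t<..<t}) {0<..<1} = 1"
    proof -
      have "{t - last_digit t<..<t} \<inter> {0<..<1} = {t - last_digit t<..<t}" using f False by auto
      then show ?thesis using f False by (simp add: ennreal_divide_self)
    qed
    moreover have "Pair t -` (A \<times> {0<..<1}) = {0<..<1::real}" using False by auto
    ultimately show ?thesis using False by simp
  next
    case True
    then have "weight x t = 0 \<or> Pair t -` (A \<times> {0<..<1::real}) = {}" by auto
    then show ?thesis using True by (metis ennreal_0 emeasure_empty indicator_simps(2) mult_zero_left mult_zero_right)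
  qed
  have "emeasure (distr (R x) (count_space E) fst) A = emeasure (R x) (A \<times> {0<..<1})"
    using A by (simp add: emeasure_distr eq)
  also have "\<dots> = (\<integral>\<^sup>+t. ennreal (weight x t) * indicator A t \<partial>count_space E)"
    by (simp only: emeasure_R[OF meas] pt)
  finally show "emeasure (distr (R x) (count_space E) fst) A = emeasure (density (count_space E) (\<lambda>t. ennreal (weight x t))) A"
    using A by (simp add: emeasure_density)
qed simp

lemma expectation_fst_R:
  fixes g :: "real \<Rightarrow> real"
  assumes x: "x \<in> Theta"
    and s: "((\<lambda>m. (exp_a x m - exp_a x (m - 1)) / x * g (exp_a x m)) has_sum s) (expansion_indices (exp_K x))"
  shows "integrable (R x) (\<lambda>\<omega>. g (fst \<omega>))" "(\<integral>\<omega>. g (fst \<omega>) \<partial>R x) = s"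
proof -
  note w = integral_weight[OF assms]
  have "integrable (distr (R x) (count_space E) fst) g"
    unfolding distr_fst_R[OF x] using w(1) weight_nonneg[OF x]
    by (subst integrable_density) (auto simp: AE_count_space)
  then show "integrable (R x) (\<lambda>\<omega>. g (fst \<omega>))" by (rule integrable_distr[rotated]) measurable
  have "(\<integral>\<omega>. g (fst \<omega>) \<partial>R x) = integral\<^sup>L (distr (R x) (count_space E) fst) g"
    by (subst integral_distr) auto
  also have "\<dots> = s"
    unfolding distr_fst_R[OF x] using w(2) weight_nonneg[OF x]
    by (subst integral_density) (auto simp: AE_count_space)
  finally show "(\<integral>\<omega>. g (fst \<omega>) \<partial>R x) = s" .
qed

lemma prob_space_R:
  assumes x: "x \<in> Theta" shows "prob_space (R x)"
proof
  have "((\<lambda>m. (exp_a x m - exp_a x (m - 1)) / x * 1) has_sum 1) (expansion_indices (exp_K x))"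
    using has_sum_cmult_left[OF exp_a_powers_telescope[OF x, of 1], of "1 / x"] x by (simp add: Theta_def)
  note w = integral_weight[OF x this]
  have "fst -` E \<inter> space (R x) = space (R x)" by (auto simp: space_R)
  then have "emeasure (R x) (space (R x)) = emeasure (distr (R x) (count_space E) fst) E"
    by (subst emeasure_distr) simp_all
  also have "\<dots> = (\<integral>\<^sup>+t. ennreal (weight x t) \<partial>count_space E)"
    unfolding distr_fst_R[OF x]
    by (subst emeasure_density) (auto intro!: nn_integral_cong simp: indicator_def)
  also have "\<dots> = ennreal (\<integral>t. weight x t \<partial>count_space E)"
    using w(1) weight_nonneg[OF x] by (intro nn_integral_eq_integral) auto
  also have "\<dots> = 1" using w(2) by simp
  finally show "emeasure (R x) (space (R x)) = 1" .
qed

lemma cond_moment_est_exp_a: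
  assumes "x \<in> Theta" "m \<in> expansion_indices (exp_K x)"
  shows "2 * exp_a x m - last_digit (exp_a x m) = exp_a x m + exp_a x (m - 1)"
  using expansion_of_exp_a(2)[OF assms] by simp

text \<open>
  Unbiasedness: the weighted estimator is \<open>(a\<^sup>2 - b\<^sup>2) / x\<close> for consecutive partial sums \<open>b\<close>, \<open>a\<close>, and this
  telescopes to \<open>x\<^sup>2 / x\<close>.
\<close>

lemma expectation_cond_moment_est:
  assumes x: "x \<in> Theta"
  shows "integrable (R x) cond_moment_est" "(\<integral>\<omega>. cond_moment_est \<omega> \<partial>R x) = x"
proof -
  let ?I = "expansion_indices (exp_K x)"
  have alg: "(a - b) / x * (a + b) = 1 / x * (a ^ 2 - b ^ 2)" for a b :: real
    by (simp add: power2_eq_square square_diff_square_factored mult.commute)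
  have "((\<lambda>m. 1 / x * (exp_a x m ^ 2 - exp_a x (m - 1) ^ 2)) has_sum 1 / x * x ^ 2) ?I"
    by (intro has_sum_cmult_right exp_a_powers_telescope x) simp
  moreover have "1 / x * x ^ 2 = x" by (simp add: power2_eq_square)
  ultimately have "((\<lambda>m. 1 / x * (exp_a x m ^ 2 - exp_a x (m - 1) ^ 2)) has_sum x) ?I"
    by (simp only:)
  then have "((\<lambda>m. (exp_a x m - exp_a x (m - 1)) / x * (2 * exp_a x m - last_digit (exp_a x m))) has_sum x) ?I"
    by (rule has_sum_cong[THEN iffD1, rotated]) (simp only: cond_moment_est_exp_a[OF x] alg)
  from expectation_fst_R[where g = "\<lambda>t. 2 * t - last_digit t", OF x this]
  show "integrable (R x) cond_moment_est" "(\<integral>\<omega>. cond_moment_est \<omega> \<partial>R x) = x"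
    by (simp_all add: cond_moment_est_def[abs_def])
qed

text \<open>
  Up to the products \<open>a b (a - b)\<close> the weighted squared error is a combination of differences of first,
  second and third powers, and these telescope to \<open>x\<^sup>3 - 2 x\<^sup>3 + x\<^sup>3 = 0\<close>.
\<close>

lemma MSE_cond_moment_est:
  assumes x: "x \<in> Theta"
  shows "MSE x cond_moment_est =
    1 / x * (\<Sum>\<^sub>\<infinity>m\<in>expansion_indices (exp_K x). exp_a x m * exp_a x (m - 1) * (exp_a x m - exp_a x (m - 1)))"
proof -
  let ?I = "expansion_indices (exp_K x)" and ?a = "exp_a x" and ?b = "\<lambda>m. exp_a x (m - 1)"
  let ?S = "\<Sum>\<^sub>\<infinity>m\<in>?I. ?a m * ?b m * (?a m - ?b m)"
  have "((\<lambda>m. (?a m ^ 3 - ?b m ^ 3) + ?a m * ?b m * (?a m - ?b m)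
        + (- 2 * x) * (?a m ^ 2 - ?b m ^ 2) + x ^ 2 * (?a m ^ 1 - ?b m ^ 1))
      has_sum (x ^ 3 + ?S + (- 2 * x) * x ^ 2 + x ^ 2 * x ^ 1)) ?I"
    by (intro has_sum_add has_sum_cmult_right exp_a_powers_telescope x has_sum_infsum error_terms_summable) simp_all
  from has_sum_cmult_right[OF this, of "1 / x"]
  have sum: "((\<lambda>m. 1 / x * ((?a m ^ 3 - ?b m ^ 3) + ?a m * ?b m * (?a m - ?b m)
        + (- 2 * x) * (?a m ^ 2 - ?b m ^ 2) + x ^ 2 * (?a m ^ 1 - ?b m ^ 1)))
      has_sum (1 / x * (x ^ 3 + ?S + (- 2 * x) * x ^ 2 + x ^ 2 * x ^ 1))) ?I" .
  have alg: "1 / x * ((a ^ 3 - b ^ 3) + a * b * (a - b) + (- 2 * x) * (a ^ 2 - b ^ 2) + x ^ 2 * (a ^ 1 - b ^ 1))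
      = (a - b) / x * (a + b - x)\<^sup>2" for a b :: real
  proof -
    have "(a ^ 3 - b ^ 3) + a * b * (a - b) + (- 2 * x) * (a ^ 2 - b ^ 2) + x ^ 2 * (a ^ 1 - b ^ 1)
      = (a - b) * (a + b - x)\<^sup>2"
      by algebra
    then show ?thesis by simp
  qed
  have tot: "x ^ 3 + S + (- 2 * x) * x ^ 2 + x ^ 2 * x ^ 1 = S" for S :: real
    by (simp add: power2_eq_square power3_eq_cube)
  have "((\<lambda>m. (?a m - ?b m) / x * (2 * ?a m - last_digit (?a m) - x)\<^sup>2) has_sum (1 / x * ?S)) ?I"
    using sum[unfolded tot]
    by (rule has_sum_cong[THEN iffD1, rotated]) (simp only: cond_moment_est_exp_a[OF x] alg)
  from expectation_fst_R(2)[where g = "\<lambda>t. (2 * t - last_digit t - x)\<^sup>2", OF x this]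
  show ?thesis by (simp add: MSE_def cond_moment_est_def)
qed

lemma var_cond_moment_est: "x \<in> Theta \<Longrightarrow> var x cond_moment_est = MSE x cond_moment_est"
  by (simp add: var_def MSE_def expectation_cond_moment_est)

section \<open>The conditional expectation given T\<close>

lemma sets_sigma_T: "sets sigma_T = {fst -` A \<inter> (E \<times> {0<..<1}) | A. A \<subseteq> E}"
  unfolding sigma_T_def by (subst sets_vimage_algebra2) auto

lemma subalgebra_sigma_T: "subalgebra (R x) sigma_T"
proof -
  have "fst -` A \<inter> (E \<times> {0<..<1}) \<in> sets (R x)" if "A \<subseteq> E" for A
    using measurable_sets[OF measurable_fst_R, of A x] that by (simp add: space_R)
  moreover have "space sigma_T = space (R x)" by (simp add: sigma_T_def space_R)
  ultimately show ?thesis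
    by (auto simp: subalgebra_def sets_sigma_T)
qed

lemma integrable_moment_est:
  assumes x: "x \<in> Theta" shows "integrable (R x) moment_est"
proof -
  interpret prob_space "R x" by (rule prob_space_R[OF x])
  have "moment_est \<in> borel_measurable (R x)" unfolding moment_est_def[abs_def] by measurable
  then show ?thesis
    by (intro integrable_const_bound[where B = 2]) (auto simp: moment_est_def space_R)
qed

lemma measurable_sigma_T_factors:
  fixes f :: "real \<times> real \<Rightarrow> real"
  assumes f: "f \<in> borel_measurable sigma_T" and "t \<in> E" "u \<in> {0<..<1}" "v \<in> {0<..<1}"
  shows "f (t, u) = f (t, v)"
proof -
  have sp: "space sigma_T = E \<times> {0<..<1}" by (simp add: sigma_T_def)
  have "f -` {f (t, u)} \<inter> space sigma_T \<in> sets sigma_T"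
    using f by (rule measurable_sets) simp
  then obtain A where "f -` {f (t, u)} \<inter> (E \<times> {0<..<1}) = fst -` A \<inter> (E \<times> {0<..<1})"
    unfolding sp sets_sigma_T by blast
  note A = this
  have "(t, u) \<in> f -` {f (t, u)} \<inter> (E \<times> {0<..<1})" using assms(2-) by simp
  then have "t \<in> A" unfolding A by simp
  then have "(t, v) \<in> fst -` A \<inter> (E \<times> {0<..<1})" using assms(2-) by simp
  then show ?thesis unfolding A[symmetric] by simp
qed

text \<open>
  On the event that \<open>T\<close> equals \<open>t\<close>, the variable \<open>X\<close> has a multiple of a uniform law. The end
  points form a null set, so the density may be taken on the closed interval.
\<close>

lemma distr_snd_fibre_R:
  assumes x: "x \<in> Theta" and t: "t \<in> E" and w: "weight x t \<noteq> 0"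
  shows "distr (density (R x) (indicator ({t} \<times> {0<..<1}))) borel snd =
    density lborel (\<lambda>s. ennreal (weight x t / last_digit t * indicator {t - last_digit t..t} s))"
proof (rule measure_eqI)
  let ?d = "last_digit t" and ?F = "{t} \<times> {0<..<1::real}"
  note f = fibre_interval[OF x w]
  fix B :: "real set" assume "B \<in> sets (distr (density (R x) (indicator ?F)) borel snd)"
  then have B [measurable]: "B \<in> sets borel" by simp
  have F: "?F \<in> sets (R x)"
    unfolding sets_R using t by (intro pair_measureI) (auto simp: sets_restrict_space_iff)
  have B': "snd -` B \<inter> space (R x) \<in> sets (R x)" by measurable
  have "emeasure (distr (density (R x) (indicator ?F)) borel snd) B
      = emeasure (R x) (?F \<inter> (snd -` B \<inter> space (R x)))"
    using F B' by (simp add: emeasure_distr emeasure_density measurable_density_eq1 flip: indicator_inter_arith)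
  also have "?F \<inter> (snd -` B \<inter> space (R x)) = {t} \<times> (B \<inter> {0<..<1})"
    using t by (auto simp: space_R)
  also have "emeasure (R x) \<dots> = ennreal (weight x t) * emeasure (uniform_measure lborel {t - ?d<..<t}) (B \<inter> {0<..<1})"
    using t by (intro emeasure_R_rectangle) auto
  also have "emeasure (uniform_measure lborel {t - ?d<..<t}) (B \<inter> {0<..<1}) = emeasure lborel ({t - ?d<..<t} \<inter> (B \<inter> {0<..<1})) / ennreal ?d"
    using f by simp
  also have "{t - ?d<..<t} \<inter> (B \<inter> {0<..<1}) = {t - ?d<..<t} \<inter> B"
    using f by auto
  also have "emeasure lborel ({t - ?d<..<t} \<inter> B) = emeasure lborel ({t - ?d..t} \<inter> B)"
  proof (rule emeasure_eq_AE)
    show "AE s in lborel. s \<in> {t - ?d<..<t} \<inter> B \<longleftrightarrow> s \<in> {t - ?d..t} \<inter> B"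
      using AE_lborel_singleton[of t] AE_lborel_singleton[of "t - ?d"] by eventually_elim auto
  qed auto
  also have "ennreal (weight x t) * (emeasure lborel ({t - ?d..t} \<inter> B) / ennreal ?d)
      = ennreal (weight x t / ?d) * emeasure lborel ({t - ?d..t} \<inter> B)"
    using f weight_nonneg[OF x, of t] by (simp add: divide_ennreal_def ennreal_mult divide_inverse inverse_ennreal mult_ac)
  also have "\<dots> = (\<integral>\<^sup>+s. ennreal (weight x t / ?d) * indicator ({t - ?d..t} \<inter> B) s \<partial>lborel)"
    by (simp add: nn_integral_cmult_indicator)
  also have "\<dots> = (\<integral>\<^sup>+s. ennreal (weight x t / ?d * indicator {t - ?d..t} s) * indicator B s \<partial>lborel)"
    by (intro nn_integral_cong) (auto simp: indicator_def)
  also have "\<dots> = emeasure (density lborel (\<lambda>s. ennreal (weight x t / ?d * indicator {t - ?d..t} s))) B"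
    by (simp add: emeasure_density)
  finally show "emeasure (distr (density (R x) (indicator ?F)) borel snd) B = \<dots>" .
qed simp

lemma fibre_integral_moment_est:
  assumes x: "x \<in> Theta" and t: "t \<in> E" and w: "weight x t \<noteq> 0"
  shows "(\<integral>\<omega>\<in>{t} \<times> {0<..<1}. moment_est \<omega> \<partial>R x) = weight x t * (2 * t - last_digit t)"
proof -
  let ?d = "last_digit t" and ?F = "{t} \<times> {0<..<1::real}"
  note f = fibre_interval[OF x w]
  have F: "?F \<in> sets (R x)"
    unfolding sets_R using t by (intro pair_measureI) (auto simp: sets_restrict_space_iff)
  have ind: "(indicator ?F :: _ \<Rightarrow> ennreal) = (\<lambda>\<omega>. ennreal (indicator ?F \<omega>))"
    by (auto simp: indicator_def)
  have "(\<integral>\<omega>\<in>?F. moment_est \<omega> \<partial>R x) = (\<integral>\<omega>. 2 * snd \<omega> \<partial>density (R x) (indicator ?F))"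
    unfolding ind using F by (subst integral_density) (auto simp: set_lebesgue_integral_def moment_est_def)
  also have "\<dots> = (\<integral>s. 2 * s \<partial>distr (density (R x) (indicator ?F)) borel snd)"
    by (subst integral_distr) auto
  also have "\<dots> = (\<integral>s. (weight x t / ?d * indicator {t - ?d..t} s) *\<^sub>R (2 * s) \<partial>lborel)"
    unfolding distr_snd_fibre_R[OF assms] using weight_nonneg[OF x, of t] f
    by (intro integral_density) auto
  also have "\<dots> = (\<integral>s. (2 * weight x t / ?d) * (s ^ 1 * indicator {t - ?d..t} s) \<partial>lborel)"
    by (rule Bochner_Integration.integral_cong[OF refl]) simp
  also have "\<dots> = (2 * weight x t / ?d) * ((t ^ 2 - (t - ?d) ^ 2) / 2)"
    using f integral_power[of "t - ?d" t 1] by (simp add: numeral_2_eq_2)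
  also have "\<dots> = weight x t * (2 * t - ?d)"
    using f by (simp add: field_simps power2_eq_square)
  finally show ?thesis .
qed

lemma measure_fibre_R:
  assumes x: "x \<in> Theta" and t: "t \<in> E" and w: "weight x t \<noteq> 0"
  shows "measure (R x) ({t} \<times> {0<..<1}) = weight x t"
proof -
  note f = fibre_interval[OF x w]
  have "{t - last_digit t<..<t} \<inter> {0<..<1} = {t - last_digit t<..<t}" using f by auto
  then have "emeasure (R x) ({t} \<times> {0<..<1}) = ennreal (weight x t)"
    using f t by (subst emeasure_R_rectangle) (simp_all add: ennreal_divide_self)
  then show ?thesis using weight_nonneg[OF x] by (simp add: measure_def)
qed

lemma AE_weight_nonzero:
  assumes x: "x \<in> Theta"
  shows "AE \<omega> in R x. weight x (fst \<omega>) \<noteq> 0"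
proof -
  have "AE t in distr (R x) (count_space E) fst. weight x t \<noteq> 0"
    unfolding distr_fst_R[OF x] by (simp add: AE_density AE_count_space)
  then show ?thesis by (subst (asm) AE_distr_iff) auto
qed

text \<open>
  As \<open>T\<close> is discrete, the conditional expectation is determined on each fibre of positive probability:
  it is constant there and has the same integral over the fibre as \<^const>\<open>moment_est\<close>. Almost surely
  \<open>T\<close> lies in such a fibre.
\<close>

lemma cond_exp_moment_est:
  assumes x: "x \<in> Theta"
  shows "AE \<omega> in R x. real_cond_exp (R x) sigma_T moment_est \<omega> = cond_moment_est \<omega>"
proof -
  interpret prob_space "R x" by (rule prob_space_R[OF x])
  interpret finite_measure_subalgebra "R x" sigma_T
    by unfold_locales (rule subalgebra_sigma_T)
  let ?f = "real_cond_exp (R x) sigma_T moment_est"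
  have val: "?f (t, u) = 2 * t - last_digit t"
    if t: "t \<in> E" and u: "u \<in> {0<..<1}" and w: "weight x t \<noteq> 0" for t u
  proof -
    let ?F = "{t} \<times> {0<..<1::real}"
    have F: "?F \<in> sets sigma_T" "?F \<in> sets (R x)"
    proof -
      have "?F = fst -` {t} \<inter> (E \<times> {0<..<1})" using t by auto
      then show "?F \<in> sets sigma_T" unfolding sets_sigma_T using t by blast
      then show "?F \<in> sets (R x)" using subalgebra_sigma_T by (auto simp: subalgebra_def)
    qed
    have "weight x t * (2 * t - last_digit t) = (\<integral>\<omega>\<in>?F. ?f \<omega> \<partial>R x)"
      using real_cond_exp_intA[OF integrable_moment_est[OF x] F(1)] fibre_integral_moment_est[OF x t w] by simp
    also have "\<dots> = (\<integral>\<omega>\<in>?F. ?f (t, u) \<partial>R x)"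
    proof (rule set_lebesgue_integral_cong[OF F(2)], intro allI impI)
      fix \<omega> assume "\<omega> \<in> ?F"
      then show "?f \<omega> = ?f (t, u)"
        using measurable_sigma_T_factors[OF borel_measurable_cond_exp t _ u] by auto
    qed
    also have "\<dots> = weight x t * ?f (t, u)"
      using F(2) measure_fibre_R[OF x t w] by (simp add: set_lebesgue_integral_def)
    finally show ?thesis using w by simp
  qed
  show ?thesis
    using AE_weight_nonzero[OF x] AE_space
  proof eventually_elim
    case (elim \<omega>)
    then show ?case using val[of "fst \<omega>" "snd \<omega>"] by (auto simp: space_R cond_moment_est_def)
  qed
qed

section \<open>One-sided limits of the variance\<close>

text \<open>
  The largest multiple of \<open>2\<^sup>-\<^sup>n\<close> strictly below \<open>x\<close>. This is the value from the left of
  the \<open>n\<close>-th truncation.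
\<close>

definition dyadic_below :: "nat \<Rightarrow> real \<Rightarrow> real" where
  "dyadic_below n x = (of_int \<lceil>2 ^ n * x\<rceil> - 1) / 2 ^ n"

definition increment_product :: "real \<Rightarrow> real \<Rightarrow> real" where
  "increment_product a b = a * b * (a - b)"

lemma increment_product_bound:
  assumes "x \<in> Theta"
  shows "\<bar>increment_product (dyadic_floor (Suc n) x) (dyadic_floor n x)\<bar> \<le> (1/2) ^ Suc n"
proof -
  have a: "0 \<le> dyadic_floor k x" "dyadic_floor k x \<le> 1" for k
    using dyadic_floor_nonneg[of x k] dyadic_floor_le[of k x] assms by (auto simp: Theta_def)
  have d: "0 \<le> dyadic_floor (Suc n) x - dyadic_floor n x" "dyadic_floor (Suc n) x - dyadic_floor n x \<le> (1/2) ^ Suc n"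
    using dyadic_floor_Suc[of n x] by auto
  have "dyadic_floor (Suc n) x * dyadic_floor n x \<le> 1" using a by (intro mult_le_one) auto
  then have "dyadic_floor (Suc n) x * dyadic_floor n x * (dyadic_floor (Suc n) x - dyadic_floor n x) \<le> 1 * (1/2) ^ Suc n"
    using a d by (intro mult_mono) auto
  then show ?thesis using a d by (simp add: increment_product_def abs_mult)
qed

lemma summable_half_Suc: "summable (\<lambda>n. (1/2::real) ^ Suc n)"
  using power_half_series by (rule sums_summable)

lemma phi_eq_suminf:
  assumes x: "x \<in> Theta"
  shows "phi x = 1 / x * (\<Sum>n. increment_product (dyadic_floor (Suc n) x) (dyadic_floor n x))"
    and "summable (\<lambda>n. increment_product (dyadic_floor (Suc n) x) (dyadic_floor n x))"
proof -
  let ?S = "\<Sum>\<^sub>\<infinity>m\<in>expansion_indices (exp_K x). exp_a x m * exp_a x (m - 1) * (exp_a x m - exp_a x (m - 1))"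
  have "((\<lambda>m. increment_product (exp_a x m) (exp_a x (m - 1))) has_sum ?S) (expansion_indices (exp_K x))"
    unfolding increment_product_def by (intro has_sum_infsum error_terms_summable x)
  then have "((\<lambda>n. increment_product (dyadic_floor (Suc n) x) (dyadic_floor n x)) has_sum ?S) UNIV"
    by (subst (asm) has_sum_expansion_iff[OF x]) (auto simp: increment_product_def)
  then have "(\<lambda>n. increment_product (dyadic_floor (Suc n) x) (dyadic_floor n x)) sums ?S"
    by (rule has_sum_imp_sums)
  moreover have "phi x = 1 / x * ?S"
    by (simp only: phi_def var_cond_moment_est[OF x] MSE_cond_moment_est[OF x])
  ultimately show "phi x = 1 / x * (\<Sum>n. increment_product (dyadic_floor (Suc n) x) (dyadic_floor n x))"
    "summable (\<lambda>n. increment_product (dyadic_floor (Suc n) x) (dyadic_floor n x))"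
    by (auto simp: sums_iff)
qed

text \<open>
  Tannery's theorem with majorant \<open>2\<^sup>-\<^sup>n\<^sup>-\<^sup>1\<close>, for a filter along which each truncation is eventually constant.
  Both one-sided neighbourhood filters are of this kind, with different constants.
\<close>

lemma phi_tendsto:
  assumes x: "x \<in> Theta" and F: "F \<noteq> bot" "F \<le> nhds x"
    and c: "\<And>n. \<forall>\<^sub>F y in F. dyadic_floor n y = c n"
  shows "(phi \<longlongrightarrow> 1 / x * (\<Sum>n. increment_product (c (Suc n)) (c n))) F"
    and "summable (\<lambda>n. increment_product (c (Suc n)) (c n))"
proof -
  have Th: "\<forall>\<^sub>F y in F. y \<in> Theta"
    by (rule filter_leD[OF F(2) eventually_nhds_in_open]) (use x in \<open>simp_all add: Theta_def\<close>)
  have lim: "((\<lambda>y. increment_product (dyadic_floor (Suc k) y) (dyadic_floor k y)) \<longlongrightarrow>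
      increment_product (c (Suc k)) (c k)) F" for k
  proof (rule tendsto_eventually)
    show "\<forall>\<^sub>F y in F. increment_product (dyadic_floor (Suc k) y) (dyadic_floor k y) = increment_product (c (Suc k)) (c k)"
      using c[of k] c[of "Suc k"] by eventually_elim simp
  qed
  have bound: "\<forall>\<^sub>F (k, y) in at_top \<times>\<^sub>F F.
      norm (increment_product (dyadic_floor (Suc k) y) (dyadic_floor k y)) \<le> (1/2) ^ Suc k"
  proof -
    have "\<forall>\<^sub>F p in at_top \<times>\<^sub>F F. True \<and> snd p \<in> Theta"
      by (rule eventually_prodI[OF _ Th]) simp
    then show ?thesis
    proof eventually_elim
      case (elim p)
      then show ?case using increment_product_bound[of "snd p" "fst p"] by (simp add: case_prod_beta)
    qed
  qed
  have tan: "summable (\<lambda>n. norm (increment_product (c (Suc n)) (c n)))"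
    "((\<lambda>y. \<Sum>n. increment_product (dyadic_floor (Suc n) y) (dyadic_floor n y))
      \<longlongrightarrow> (\<Sum>n. increment_product (c (Suc n)) (c n))) F"
    using tannerys_theorem[where a = "\<lambda>n y. increment_product (dyadic_floor (Suc n) y) (dyadic_floor n y)",
        OF lim bound summable_half_Suc F(1)] by simp_all
  show "summable (\<lambda>n. increment_product (c (Suc n)) (c n))"
    by (rule summable_norm_cancel[OF tan(1)])
  have id: "((\<lambda>y. y) \<longlongrightarrow> x) F" using F(2) by (simp add: filterlim_def)
  have "x \<noteq> 0" using x by (simp add: Theta_def)
  then have "((\<lambda>y. 1 / y * (\<Sum>n. increment_product (dyadic_floor (Suc n) y) (dyadic_floor n y)))
      \<longlongrightarrow> 1 / x * (\<Sum>n. increment_product (c (Suc n)) (c n))) F"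
    by (intro tendsto_mult tendsto_divide tendsto_const id tan(2))
  then show "(phi \<longlongrightarrow> 1 / x * (\<Sum>n. increment_product (c (Suc n)) (c n))) F"
  proof (rule Lim_transform_eventually)
    show "\<forall>\<^sub>F y in F. 1 / y * (\<Sum>n. increment_product (dyadic_floor (Suc n) y) (dyadic_floor n y)) = phi y"
      using Th by eventually_elim (rule phi_eq_suminf(1)[symmetric])
  qed
qed

lemma dyadic_floor_eventually_right: "\<forall>\<^sub>F y in at_right x. dyadic_floor n y = dyadic_floor n x"
proof -
  have "\<forall>\<^sub>F y in at_right x. y < (of_int \<lfloor>2 ^ n * x\<rfloor> + 1) / 2 ^ n"
  proof (rule order_tendstoD(2)[OF tendsto_ident_at])
    have "2 ^ n * x < of_int \<lfloor>2 ^ n * x\<rfloor> + 1" by linarith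
    then show "x < (of_int \<lfloor>2 ^ n * x\<rfloor> + 1) / 2 ^ n" by (simp add: pos_less_divide_eq mult.commute)
  qed
  moreover have "\<forall>\<^sub>F y in at_right x. x < y" by (rule eventually_at_right_less)
  ultimately show ?thesis
  proof eventually_elim
    case (elim y)
    then have "2 ^ n * y < of_int \<lfloor>2 ^ n * x\<rfloor> + 1" by (simp add: pos_less_divide_eq mult.commute)
    moreover have "2 ^ n * x < 2 ^ n * y" using elim by simp
    ultimately have "\<lfloor>2 ^ n * y\<rfloor> = \<lfloor>2 ^ n * x\<rfloor>" by linarith
    then show ?case by (simp add: dyadic_floor_def)
  qed
qed

lemma dyadic_floor_eventually_left: "\<forall>\<^sub>F y in at_left x. dyadic_floor n y = dyadic_below n x"
proof -
  have "\<forall>\<^sub>F y in at_left x. (of_int \<lceil>2 ^ n * x\<rceil> - 1) / 2 ^ n < y"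
  proof (rule order_tendstoD(1)[OF tendsto_ident_at])
    have "of_int \<lceil>2 ^ n * x\<rceil> - 1 < 2 ^ n * x" by linarith
    then show "(of_int \<lceil>2 ^ n * x\<rceil> - 1) / 2 ^ n < x" by (simp add: field_simps)
  qed
  moreover have "\<forall>\<^sub>F y in at_left x. y < x" by (simp add: eventually_at_filter)
  ultimately show ?thesis
  proof eventually_elim
    case (elim y)
    then have "of_int \<lceil>2 ^ n * x\<rceil> - 1 < 2 ^ n * y" by (simp add: field_simps)
    moreover have "2 ^ n * y < 2 ^ n * x" using elim by simp
    ultimately have "\<lfloor>2 ^ n * y\<rfloor> = \<lceil>2 ^ n * x\<rceil> - 1" by linarith
    then show ?case by (simp add: dyadic_floor_def dyadic_below_def)
  qed
qed

lemma phi_right_continuous: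
  assumes x: "x \<in> Theta"
  shows "(phi \<longlongrightarrow> phi x) (at_right x)"
proof -
  have "at_right x \<le> nhds x" by (simp add: at_within_def)
  from phi_tendsto(1)[OF x _ this dyadic_floor_eventually_right]
  show ?thesis by (simp add: phi_eq_suminf(1)[OF x])
qed

lemma phi_left_limit:
  assumes x: "x \<in> Theta"
  shows "(phi \<longlongrightarrow> 1 / x * (\<Sum>n. increment_product (dyadic_below (Suc n) x) (dyadic_below n x))) (at_left x)"
    and "summable (\<lambda>n. increment_product (dyadic_below (Suc n) x) (dyadic_below n x))"
proof -
  have "at_left x \<le> nhds x" by (simp add: at_within_def)
  from phi_tendsto[OF x _ this dyadic_floor_eventually_left]
  show "(phi \<longlongrightarrow> 1 / x * (\<Sum>n. increment_product (dyadic_below (Suc n) x) (dyadic_below n x))) (at_left x)"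
    "summable (\<lambda>n. increment_product (dyadic_below (Suc n) x) (dyadic_below n x))" by simp_all
qed

lemma dyadic_below_eq_floor:
  assumes "2 ^ n * x \<notin> \<int>"
  shows "dyadic_below n x = dyadic_floor n x"
proof -
  have "\<lceil>2 ^ n * x\<rceil> = \<lfloor>2 ^ n * x\<rfloor> + 1"
    using assms by (simp add: ceiling_altdef) (metis Ints_of_int)
  then show ?thesis by (simp add: dyadic_below_def dyadic_floor_def)
qed

text \<open>
  Off \<^const>\<open>E\<close> no \<^term>\<open>2 ^ n * x\<close> is an integer, so the limits of all truncations from the two sides agree.
\<close>

lemma phi_isCont:
  assumes x: "x \<in> Theta - E"
  shows "isCont phi x"
proof -
  have x': "x \<in> Theta" using x by simp
  have "2 ^ n * x \<notin> \<int>" for n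
    using x dyadic_mem_E[of x n] by (auto simp: Theta_def elim!: Ints_cases)
  then have "dyadic_below n x = dyadic_floor n x" for n by (rule dyadic_below_eq_floor)
  then have "(phi \<longlongrightarrow> phi x) (at_left x)"
    using phi_left_limit(1)[OF x'] by (simp add: phi_eq_suminf(1)[OF x'])
  then show ?thesis
    unfolding isCont_def using phi_right_continuous[OF x'] by (rule filterlim_split_at)
qed

lemma dyadic_at_integer:
  assumes "2 ^ n * x = of_int k"
  shows "dyadic_floor n x = x" "dyadic_below n x = x - (1/2) ^ n"
  using assms by (simp_all add: dyadic_floor_def dyadic_below_def field_simps)

text \<open>
  Let \<open>h = 2\<^sup>-\<^sup>L\<close>. Truncations coarser than \<open>h\<close> have the same limits from both sides. At level \<open>L\<close> the last
  digit of \<open>x\<close> produces the term \<open>x (x - h) h\<close> on the right only. Beyond level \<open>L\<close> the right series stops,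
  whereas the left limits \<open>x - h 2\<^sup>-\<^sup>k\<close> at level \<open>L + k\<close> give \<open>(x - h 2\<^sup>-\<^sup>k\<^sup>-\<^sup>1) (x - h 2\<^sup>-\<^sup>k) h 2\<^sup>-\<^sup>k\<^sup>-\<^sup>1\<close>, a
  combination of geometric series of ratios 1/2, 1/4 and 1/8. The difference is \<open>- 2 h\<^sup>3 / 7\<close>, and
  division by \<open>x = q h\<close> gives the jump.
\<close>

lemma phi_jump:
  fixes L q :: nat
  assumes x: "x \<in> Theta" and L: "1 \<le> L" and q: "odd q" and xq: "x = real q * (1/2) ^ L"
  shows "phi x - Lim (at_left x) phi = - (2 * ((1/2) ^ L)\<^sup>2 / (7 * real q))"
proof -
  define h where "h = (1/2::real) ^ L"
  define D where "D n = increment_product (dyadic_floor (Suc n) x) (dyadic_floor n x)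
    - increment_product (dyadic_below (Suc n) x) (dyadic_below n x)" for n
  have xh: "x = real q * h" using xq by (simp add: h_def)
  have coarse: "dyadic_below n x = dyadic_floor n x" if "n < L" for n
  proof (rule dyadic_below_eq_floor, rule notI)
    assume "2 ^ n * x \<in> \<int>"
    then obtain z where z: "2 ^ n * x = of_int z" by (auto elim: Ints_cases)
    have "(2::real) ^ L = 2 ^ (L - n) * 2 ^ n" using that by (simp flip: power_add)
    then have "real q = of_int (2 ^ (L - n) * z)"
      using z xq by (simp add: power_one_over field_simps)
    then have "int q = 2 ^ (L - n) * z" by (metis of_int_eq_iff of_int_of_nat_eq)
    then have "even (int q)" using that by simp
    then show False using q by simp
  qed
  have fine: "dyadic_floor (k + L) x = x" "dyadic_below (k + L) x = x - h * (1/2) ^ k" for k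
  proof -
    have "2 ^ (k + L) * x = of_int (2 ^ k * int q)"
      using xq by (simp add: power_add power_one_over)
    from dyadic_at_integer[OF this]
    show "dyadic_floor (k + L) x = x" "dyadic_below (k + L) x = x - h * (1/2) ^ k"
      by (simp_all add: h_def power_add mult.commute)
  qed
  \<comment> \<open>As \<open>q\<close> is odd, \<open>x\<close> lies midway between two multiples of \<open>2 h\<close>.\<close>
  have pred: "dyadic_floor (L - 1) x = x - h"
  proof (rule dyadic_floor_eqI)
    define r where "r = q div 2"
    have r: "q = 2 * r + 1" using q by (simp add: r_def)
    have hL: "(2::real) ^ (L - 1) * h = 1 / 2"
      using L by (cases L) (simp_all add: h_def power_one_over)
    have "2 ^ (L - 1) * (x - h) = (2 ^ (L - 1) * h) * (real q - 1)" by (simp add: xh algebra_simps)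
    then show "2 ^ (L - 1) * (x - h) = of_int (int r)" unfolding hL r by simp
    show "x - h \<le> x" by (simp add: h_def)
    have "(1/2::real) ^ (L - 1) = 2 * h" using L by (cases L) (simp_all add: h_def)
    then show "x < x - h + (1/2) ^ (L - 1)" by (simp add: h_def)
  qed
  \<comment> \<open>Only \<open>n = L - 1\<close> contributes, where the truncations at levels \<open>L - 1\<close> and \<open>L\<close> meet.\<close>
  have head: "(\<Sum>n<L. D n) = x * (x - h) * h"
  proof -
    have "(\<Sum>n<L. D n) = (\<Sum>n\<in>{L - 1}. D n)"
    proof (rule sum.mono_neutral_right)
      show "\<forall>n\<in>{..<L} - {L - 1}. D n = 0"
      proof
        fix n assume "n \<in> {..<L} - {L - 1}"
        then have "n < L" "Suc n < L" by auto
        then show "D n = 0" by (simp add: D_def coarse)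
      qed
    qed (use L in auto)
    also have "\<dots> = x * (x - h) * h"
      using L fine[of 0] pred coarse[of "L - 1"] by (simp add: D_def increment_product_def)
    finally show ?thesis .
  qed
  have geo: "(\<lambda>k. c ^ k) sums (1 / (1 - c))" if "\<bar>c\<bar> < 1" for c :: real
    using geometric_sums[of c] that by simp
  have tail: "(\<lambda>k. D (k + L)) sums (- (h * x\<^sup>2) + x * h\<^sup>2 - 2 * h ^ 3 / 7)"
  proof -
    have sum: "(\<lambda>k. - (h * x\<^sup>2 / 2) * (1/2) ^ k + (3 * x * h\<^sup>2 / 4) * (1/4) ^ k - (h ^ 3 / 4) * (1/8) ^ k) sums
      (- (h * x\<^sup>2 / 2) * (1 / (1 - 1/2)) + (3 * x * h\<^sup>2 / 4) * (1 / (1 - 1/4)) - (h ^ 3 / 4) * (1 / (1 - 1/8)))"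
      by (intro sums_add sums_diff sums_mult geo) simp_all
    have val: "- (h * x\<^sup>2 / 2) * (1 / (1 - 1/2)) + (3 * x * h\<^sup>2 / 4) * (1 / (1 - 1/4)) - (h ^ 3 / 4) * (1 / (1 - 1/8))
      = - (h * x\<^sup>2) + x * h\<^sup>2 - 2 * h ^ 3 / 7"
      by (simp add: field_simps)
    have summand: "D (k + L) = - (h * x\<^sup>2 / 2) * (1/2) ^ k + (3 * x * h\<^sup>2 / 4) * (1/4) ^ k - (h ^ 3 / 4) * (1/8) ^ k" for k
    proof -
      define u where "u = (1/2::real) ^ k"
      have u: "(1/4::real) ^ k = u ^ 2" "(1/8::real) ^ k = u ^ 3"
        using power_mult[of "1/2::real" 2 k] power_mult[of "1/2::real" k 2]
          power_mult[of "1/2::real" 3 k] power_mult[of "1/2::real" k 3]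
        by (simp_all add: u_def mult.commute[of k] power_divide)
      have "D (k + L) = - increment_product (x - h * (u / 2)) (x - h * u)"
        using fine[of k] fine[of "Suc k"] by (simp add: D_def u_def increment_product_def)
      then show ?thesis unfolding u u_def[symmetric]
        by (simp add: increment_product_def power2_eq_square power3_eq_cube field_simps)
    qed
    show ?thesis unfolding summand using sum unfolding val .
  qed
  have "D sums (- (2 * h ^ 3 / 7))"
    using tail unfolding sums_iff_shift head by (simp add: algebra_simps power2_eq_square)
  moreover have "D sums ((\<Sum>n. increment_product (dyadic_floor (Suc n) x) (dyadic_floor n x))
      - (\<Sum>n. increment_product (dyadic_below (Suc n) x) (dyadic_below n x)))"
    unfolding D_def by (intro sums_diff summable_sums phi_eq_suminf(2) phi_left_limit(2) x)
  ultimately have S: "(\<Sum>n. increment_product (dyadic_floor (Suc n) x) (dyadic_floor n x))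
      - (\<Sum>n. increment_product (dyadic_below (Suc n) x) (dyadic_below n x)) = - (2 * h ^ 3 / 7)"
    by (rule sums_unique2[symmetric])
  have "Lim (at_left x) phi = 1 / x * (\<Sum>n. increment_product (dyadic_below (Suc n) x) (dyadic_below n x))"
    by (rule tendsto_Lim[OF _ phi_left_limit(1)[OF x]]) simp
  then have "phi x - Lim (at_left x) phi = 1 / x * (- (2 * h ^ 3 / 7))"
    unfolding phi_eq_suminf(1)[OF x] S[symmetric] by (simp add: right_diff_distrib)
  also have "\<dots> = - (2 * h\<^sup>2 / (7 * real q))"
    using q by (simp add: xh h_def power2_eq_square power3_eq_cube field_simps)
  finally show ?thesis by (simp add: h_def)
qed

theorem proposition13:
  shows "(\<forall>\<theta>\<in>Theta.
            AE \<omega> in R \<theta>. real_cond_exp (R \<theta>) sigma_T moment_est \<omega> = cond_moment_est \<omega>)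
     \<and> (\<forall>\<theta>\<in>Theta.
            MSE \<theta> cond_moment_est = var \<theta> cond_moment_est
          \<and> (\<lambda>m. exp_a \<theta> m * exp_a \<theta> (m - 1) * (exp_a \<theta> m - exp_a \<theta> (m - 1)))
              summable_on expansion_indices (exp_K \<theta>)
          \<and> var \<theta> cond_moment_est =
              1 / \<theta> * (\<Sum>\<^sub>\<infinity>m\<in>expansion_indices (exp_K \<theta>).
                exp_a \<theta> m * exp_a \<theta> (m - 1) * (exp_a \<theta> m - exp_a \<theta> (m - 1))))
     \<and> (\<forall>\<theta>\<in>Theta - E. isCont phi \<theta>)
     \<and> (\<forall>\<theta>\<in>E. continuous (at_right \<theta>) phi \<and> (\<exists>l. (phi \<longlongrightarrow> l) (at_left \<theta>)))
     \<and> (\<forall>\<theta>\<in>Theta. \<forall>L q :: nat. L \<ge> 1 \<and> q \<ge> 1 \<and> odd q \<and> \<theta> = real q * 2 powi (- int L) \<longrightarrow>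
            phi \<theta> - Lim (at_left \<theta>) phi = - (1 / (7 * real q)) * 2 powi (- 2 * int L + 1))"
proof (intro conjI ballI allI impI)
  fix x assume x: "x \<in> Theta"
  show "AE \<omega> in R x. real_cond_exp (R x) sigma_T moment_est \<omega> = cond_moment_est \<omega>"
    by (rule cond_exp_moment_est[OF x])
  show "MSE x cond_moment_est = var x cond_moment_est"
    by (simp add: var_cond_moment_est[OF x])
  show "(\<lambda>m. exp_a x m * exp_a x (m - 1) * (exp_a x m - exp_a x (m - 1))) summable_on expansion_indices (exp_K x)"
    by (rule error_terms_summable[OF x])
  show "var x cond_moment_est = 1 / x * (\<Sum>\<^sub>\<infinity>m\<in>expansion_indices (exp_K x).
      exp_a x m * exp_a x (m - 1) * (exp_a x m - exp_a x (m - 1)))"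
    by (simp only: var_cond_moment_est[OF x] MSE_cond_moment_est[OF x])
next
  fix x assume "x \<in> Theta - E"
  then show "isCont phi x" by (rule phi_isCont)
next
  fix x assume "x \<in> E"
  then have x: "x \<in> Theta" by (simp add: E_def Theta_def)
  show "continuous (at_right x) phi"
    using phi_right_continuous[OF x] by (simp add: continuous_within)
  show "\<exists>l. (phi \<longlongrightarrow> l) (at_left x)"
    using phi_left_limit(1)[OF x] by blast
next
  fix x and L q :: nat
  assume x: "x \<in> Theta" and a: "L \<ge> 1 \<and> q \<ge> 1 \<and> odd q \<and> x = real q * 2 powi (- int L)"
  have h: "2 powi (- int L) = (1/2::real) ^ L"
    by (simp add: power_int_minus power_one_over inverse_eq_divide)
  have "2 powi (- 2 * int L + 1) = 2 * (2 powi (- int L) * 2 powi (- int L) :: real)"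
    by (simp add: power_int_add flip: power_int_add_1' power_int_add)
  then have p: "2 powi (- 2 * int L + 1) = 2 * ((1/2::real) ^ L)\<^sup>2"
    by (simp add: h power2_eq_square)
  show "phi x - Lim (at_left x) phi = - (1 / (7 * real q)) * 2 powi (- 2 * int L + 1)"
    using phi_jump[OF x, of L q] a unfolding p h by simp
qed

end
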